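(* Let $n\geq 1$ and let $\alpha$ be a positive $(2,2)$-form in $\mathbb C^n$. Then the $(4,4)$-form $\alpha^2=\alpha\wedge\alpha$ is also positive.
   Context: Forms are constant-coefficient forms on $\mathbb C^n$, i.e. elements of the exterior algebra generated by $(\mathbb C^n)^\ast$ and its conjugate. A $(p,p)$-form $\alpha$ in $\mathbb C^n$ is called positive (written $\alpha\geq 0$) if for all $(1,0)$-forms $\gamma_1,\dots,\gamma_{n-p}\in(\mathbb C^n)^\ast$ one has $\alpha\wedge i\gamma_1\wedge\bar\gamma_1\wedge\dots\wedge i\gamma_{n-p}\wedge\bar\gamma_{n-p}\geq 0$, meaning this $(n,n)$-form is a nonnegative real multiple of the standard volume form $idz_1\wedge d\bar z_1\wedge\dots\wedge idz_n\wedge d\bar z_n$. (A $(p,p)$-form with $p>n$ is zero and counts as positive.) *)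

theory Defs
  imports Complex_Main
begin

text \<open>Constant-coefficient forms on C^n. A form is given by its coefficient function:
  the value at (I,J) is the coefficient of dz_I \<and> dzbar_J, where dz_I = dz_{i1} \<and> ... \<and> dz_{ik}
  for I = {i1 < ... < ik} and likewise dzbar_J. Coordinates are indexed by 0..n-1.
  This is the standard basis of the exterior algebra on the 2n generators ordered
  dz_0 < ... < dz_(n-1) < dzbar_0 < ... < dzbar_(n-1).\<close>

type_synonym form = "nat set \<times> nat set \<Rightarrow> complex"

definition is_form :: "nat \<Rightarrow> nat \<Rightarrow> nat \<Rightarrow> form \<Rightarrow> bool" where
  "is_form n p q a \<longleftrightarrow> (\<forall>I J. a (I, J) \<noteq> 0 \<longrightarrow>
      I \<subseteq> {..<n} \<and> J \<subseteq> {..<n} \<and> card I = p \<and> card J = q)"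

text \<open>Sign of the permutation sorting the concatenation of the increasing lists A, B.\<close>
definition shuffle_sign :: "nat set \<Rightarrow> nat set \<Rightarrow> complex" where
  "shuffle_sign A B = (-1) ^ card {(a, b). a \<in> A \<and> b \<in> B \<and> b < a}"

definition wedge :: "form \<Rightarrow> form \<Rightarrow> form" where
  "wedge a b = (\<lambda>(I, J). \<Sum>I1\<in>Pow I. \<Sum>J1\<in>Pow J.
      (-1) ^ (card J1 * card (I - I1)) * shuffle_sign I1 (I - I1) * shuffle_sign J1 (J - J1)
      * a (I1, J1) * b (I - I1, J - J1))"

definition form_one :: form where
  "form_one = (\<lambda>(I, J). if I = {} \<and> J = {} then 1 else 0)"

definition form10 :: "nat \<Rightarrow> (nat \<Rightarrow> complex) \<Rightarrow> form" where
  "form10 n c = (\<lambda>(I, J). if J = {} \<and> (\<exists>j<n. I = {j}) then c (the_elem I) else 0)"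

definition form10_conj :: "nat \<Rightarrow> (nat \<Rightarrow> complex) \<Rightarrow> form" where
  "form10_conj n c = (\<lambda>(I, J). if I = {} \<and> (\<exists>j<n. J = {j}) then cnj (c (the_elem J)) else 0)"

definition scale_form :: "complex \<Rightarrow> form \<Rightarrow> form" where
  "scale_form s a = (\<lambda>x. s * a x)"

fun sp_prod :: "nat \<Rightarrow> (nat \<Rightarrow> nat \<Rightarrow> complex) \<Rightarrow> nat \<Rightarrow> form" where
  "sp_prod n \<gamma> 0 = form_one"
| "sp_prod n \<gamma> (Suc m) = wedge (sp_prod n \<gamma> m)
      (scale_form \<i> (wedge (form10 n (\<gamma> m)) (form10_conj n (\<gamma> m))))"

definition vol :: "nat \<Rightarrow> form" where
  "vol n = sp_prod n (\<lambda>k j. if j = k then 1 else 0) n"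

definition nonneg_top :: "nat \<Rightarrow> form \<Rightarrow> bool" where
  "nonneg_top n w \<longleftrightarrow> (\<exists>c::real. c \<ge> 0 \<and> w = scale_form (complex_of_real c) (vol n))"

definition positive_form :: "nat \<Rightarrow> nat \<Rightarrow> form \<Rightarrow> bool" where
  "positive_form n p a \<longleftrightarrow> is_form n p p a \<and>
     (p > n \<or> (\<forall>\<gamma> :: nat \<Rightarrow> nat \<Rightarrow> complex. nonneg_top n (wedge a (sp_prod n \<gamma> (n - p)))))"

end

theory Submission
  imports Defs "HOL-Analysis.Analysis"
begin

text \<open>
  Let \<open>\<beta>\<close> be the product of the \<open>i \<gamma>\<^sub>j \<and> \<gamma>\<^sub>j-bar\<close> for \<open>n - 4\<close> covectors. Modulo the annihilator of \<open>\<beta>\<close>,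
  every covector is a combination of four of the \<open>dz\<^sub>s\<close>, so \<open>\<alpha>\<close> becomes a form on \<open>C\<^sup>4\<close>, given by a
  6 x 6 matrix \<open>A\<close> on the bivectors. In a basis of the bivectors that is orthonormal up to a factor
  for the quadratic form \<open>u \<mapsto> u \<and> u\<close>, a bivector is decomposable iff its coordinates satisfy
  \<open>\<Sum> z\<^sub>i\<^sup>2 = 0\<close>. Positivity of \<open>\<alpha>\<close> says that the sesquilinear form of \<open>A\<close> is nonnegative on these
  vectors, and \<open>\<alpha> \<and> \<alpha> \<and> \<beta>\<close> is a nonnegative multiple of \<open>\<Sum> A\<^sub>i\<^sub>j\<^sup>2\<close>.

  Write \<open>A = S + i T\<close> with \<open>S, T\<close> real. Testing on vectors \<open>x + i y\<close> with \<open>x, y\<close> real orthonormal shows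
  that \<open>S\<close> is symmetric, \<open>T\<close> is skew and \<open>2 \<bar>x \<bullet> T y\<bar> \<le> x \<bullet> S x + y \<bullet> S y\<close>. In an orthonormal basis in
  which \<open>T\<close> is a sum of 2 x 2 skew blocks this bounds the Frobenius norm of \<open>T\<close> by that of \<open>S\<close>, which
  is the inequality \<open>\<Sum> A\<^sub>i\<^sub>j\<^sup>2 \<ge> 0\<close>.
\<close>

section \<open>Skew forms dominated by symmetric forms\<close>

text \<open>If \<open>K\<close> vanishes on \<open>V\<close>, any orthonormal basis works, with
  \<open>p\<close> the identity. Otherwise a unit vector of \<open>V\<close> maximising the norm of
  \<open>K x\<close> spans an invariant plane together with its image, and the induction continues
  on the orthogonal complement in \<open>V\<close>. A fixed point \<open>p b = b\<close> forces
  \<open>K b = 0\<close>, since \<open>K b\<close> is orthogonal to \<open>b\<close>.\<close>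

lemma skew_normal_basis:
  fixes K :: "'a::euclidean_space \<Rightarrow> 'a"
  assumes lin: "linear K" and skew: "\<And>x y. x \<bullet> K y = - (K x \<bullet> y)"
    and "subspace V" and "K ` V \<subseteq> V"
  shows "\<exists>B p. finite B \<and> B \<subseteq> V \<and> span B = V \<and> pairwise orthogonal B \<and> (\<forall>b\<in>B. norm b = 1)
    \<and> (\<forall>b\<in>B. p b \<in> B \<and> p (p b) = b \<and> K b = (K b \<bullet> p b) *\<^sub>R p b)"
  using assms(3,4)
proof (induction "dim V" arbitrary: V rule: less_induct)
  case less
  have skew0: "x \<bullet> K x = 0" for x
    using skew[of x x] by (simp add: inner_commute)
  show ?case
  proof (cases "\<forall>v\<in>V. K v = 0")
    case True
    obtain B where B: "B \<subseteq> V" "pairwise orthogonal B" "\<And>x. x \<in> B \<Longrightarrow> norm x = 1"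
      "independent B" "card B = dim V" "span B = V"
      using orthonormal_basis_subspace[OF less.prems(1)] by metis
    have "finite B" using B(4) independent_bound_general finiteI_independent by blast
    then show ?thesis
      using B True by (intro exI[of _ B] exI[of _ id]) auto
  next
    case False
    then obtain v0 where v0: "v0 \<in> V" "K v0 \<noteq> 0" by blast
    have "v0 \<noteq> 0" using v0 linear_0[OF lin] by auto
    let ?U = "V \<inter> sphere 0 1"
    have "compact ?U"
      using less.prems(1) by (simp add: closed_Int_compact closed_subspace)
    moreover have "(1 / norm v0) *\<^sub>R v0 \<in> ?U"
      using v0 \<open>v0 \<noteq> 0\<close> less.prems(1) by (simp add: subspace_scale)
    moreover have "continuous_on ?U (\<lambda>x. norm (K x))"
      by (intro continuous_intros linear_continuous_on linear_conv_bounded_linear[THEN iffD1] lin)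
    ultimately obtain x where x: "x \<in> ?U" and max: "\<And>z. z \<in> ?U \<Longrightarrow> norm (K z) \<le> norm (K x)"
      by (metis (no_types, lifting) continuous_attains_sup empty_iff)
    define l where "l = norm (K x)"
    have xV: "x \<in> V" and nx: "norm x = 1" using x by auto
    have lpos: "l > 0"
    proof -
      have "norm (K ((1 / norm v0) *\<^sub>R v0)) \<le> l"
        unfolding l_def by (rule max) fact
      moreover have "norm (K ((1 / norm v0) *\<^sub>R v0)) > 0"
        using v0 \<open>v0 \<noteq> 0\<close> by (simp add: linear_scale[OF lin])
      ultimately show ?thesis by linarith
    qed
    define y where "y = (1 / l) *\<^sub>R K x"
    have Kx: "K x = l *\<^sub>R y" using lpos by (simp add: y_def)
    have yV: "y \<in> V"
      using less.prems xV by (auto simp: y_def intro!: subspace_scale)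
    have ny: "norm y = 1" using lpos by (simp add: y_def l_def)
    have xy: "x \<bullet> y = 0" by (simp add: y_def skew0)
    have xx: "x \<bullet> x = 1" and yy: "y \<bullet> y = 1" using nx ny by (simp_all add: norm_eq_1)
    have xKy: "x \<bullet> K y = - l" using skew[of x y] Kx yy by simp
    have Kyl: "norm (K y) \<le> l" unfolding l_def using max yV ny by simp
    \<comment> \<open>The equality case of Cauchy-Schwarz: maximality bounds the norm of
      \<open>K y\<close> by \<open>l\<close>, while its component along \<open>x\<close> is already
      \<open>- l\<close>.\<close>
    have Ky: "K y = - l *\<^sub>R x"
    proof -
      have "(norm (K y + l *\<^sub>R x))\<^sup>2 = (norm (K y))\<^sup>2 - l\<^sup>2"
        unfolding power2_norm_eq_inner using xKy xx
        by (simp add: inner_add_left inner_add_right inner_commute[of "K y" x] power2_eq_square)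
      also have "\<dots> \<le> 0" using Kyl by (simp add: power_mono)
      finally show ?thesis by (simp add: eq_neg_iff_add_eq_0)
    qed
    \<comment> \<open>The orthogonal complement of the plane in \<open>V\<close>. It is invariant
      because \<open>K\<close> is skew and maps the plane to itself.\<close>
    define W where "W = {v \<in> V. v \<bullet> x = 0 \<and> v \<bullet> y = 0}"
    have subW: "subspace W"
      using less.prems(1) by (auto simp: W_def subspace_def inner_add_left)
    have "K ` W \<subseteq> W"
    proof -
      have "K v \<bullet> x = 0 \<and> K v \<bullet> y = 0" if "v \<bullet> x = 0" "v \<bullet> y = 0" for v
        using that skew[of v x] skew[of v y] Kx Ky by simp
      then show ?thesis using less.prems(2) by (auto simp: W_def)
    qed
    moreover have "dim W < dim V"
    proof (rule dim_psubset)
      have "x \<notin> W" using xx by (simp add: W_def)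
      moreover have "W \<subseteq> V" by (auto simp: W_def)
      ultimately have "W \<subset> V" using xV by blast
      then show "span W \<subset> span V"
        using subW less.prems(1) by (metis span_eq_iff)
    qed
    ultimately obtain B p where B: "finite B" "B \<subseteq> W" "span B = W" "pairwise orthogonal B"
      "\<And>b. b \<in> B \<Longrightarrow> norm b = 1"
      and p: "\<And>b. b \<in> B \<Longrightarrow> p b \<in> B" "\<And>b. b \<in> B \<Longrightarrow> p (p b) = b"
        "\<And>b. b \<in> B \<Longrightarrow> K b = (K b \<bullet> p b) *\<^sub>R p b"
      using less.hyps subW by metis
    have notB: "x \<notin> B" "y \<notin> B" using B(2) xx yy by (auto simp: W_def)
    have "x \<noteq> y" using xy xx by auto
    define B' where "B' = insert x (insert y B)"
    define p' where "p' = p(x := y, y := x)"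
    have "B' \<subseteq> V" using B(2) xV yV by (auto simp: B'_def W_def)
    moreover have "V \<subseteq> span B'"
    proof
      fix v assume v: "v \<in> V"
      have "v - (v \<bullet> x) *\<^sub>R x - (v \<bullet> y) *\<^sub>R y \<in> W"
        using v xV yV less.prems(1) xx yy xy
        by (simp add: W_def subspace_diff subspace_scale inner_diff_left inner_commute[of y x])
      then have "v - (v \<bullet> x) *\<^sub>R x - (v \<bullet> y) *\<^sub>R y \<in> span B'"
        using B(3) span_mono[of B B'] by (auto simp: B'_def)
      then have "(v - (v \<bullet> x) *\<^sub>R x - (v \<bullet> y) *\<^sub>R y) + (v \<bullet> x) *\<^sub>R x + (v \<bullet> y) *\<^sub>R y \<in> span B'"
        by (intro span_add span_scale) (auto simp: B'_def intro: span_base)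
      then show "v \<in> span B'" by simp
    qed
    ultimately have "span B' = V"
      using less.prems(1) by (simp add: span_minimal subset_antisym)
    moreover have "pairwise orthogonal B'"
      using B(2,4) xy by (auto simp: B'_def pairwise_insert orthogonal_def W_def inner_commute)
    moreover have "\<forall>b\<in>B'. norm b = 1" using B(5) nx ny by (auto simp: B'_def)
    moreover have "p' b \<in> B' \<and> p' (p' b) = b \<and> K b = (K b \<bullet> p' b) *\<^sub>R p' b" if "b \<in> B'" for b
    proof (cases "b \<in> B")
      case True
      then have "p b \<in> B" using p by blast
      with True notB have "p' b = p b" "p' (p' b) = p (p b)" by (auto simp: p'_def)
      with p True show ?thesis by (simp add: B'_def)
    next
      case False
      then have "b = x \<or> b = y" using that by (auto simp: B'_def)
      then show ?thesis using \<open>x \<noteq> y\<close> Kx Ky xx yy by (auto simp: B'_def p'_def)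
    qed
    ultimately show ?thesis using B(1) \<open>B' \<subseteq> V\<close>
      by (intro exI[of _ B'] exI[of _ p']) (auto simp: B'_def)
  qed
qed

lemma orthonormal_parseval:
  fixes B :: "'a::euclidean_space set"
  assumes "finite B" "span B = UNIV" "pairwise orthogonal B" "\<And>b. b \<in> B \<Longrightarrow> norm b = 1"
  shows "(norm v)\<^sup>2 = (\<Sum>b\<in>B. (v \<bullet> b)\<^sup>2)"
proof -
  have "v \<in> range (\<lambda>u. \<Sum>b\<in>B. u b *\<^sub>R b)"
    using span_finite[OF assms(1)] assms(2) by blast
  then obtain u where v: "v = (\<Sum>b\<in>B. u b *\<^sub>R b)" by blast
  have bb: "b \<bullet> c = (if b = c then 1 else 0)" if "b \<in> B" "c \<in> B" for b c
    using that assms(3,4) by (auto simp: pairwise_def orthogonal_def norm_eq_1)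
  have u: "v \<bullet> b = u b" if "b \<in> B" for b
    using that assms(1) by (simp add: v inner_sum_left bb if_distrib cong: if_cong sum.cong)
  have "(norm v)\<^sup>2 = v \<bullet> (\<Sum>b\<in>B. u b *\<^sub>R b)"
    unfolding power2_norm_eq_inner by (simp only: v[symmetric])
  then have "(norm v)\<^sup>2 = (\<Sum>b\<in>B. u b * (v \<bullet> b))" by (simp add: inner_sum_right)
  then show ?thesis using u by (simp add: power2_eq_square)
qed

text \<open>By Parseval, both sides are the sum of all squares
  \<open>(b \<bullet> f i)\<^sup>2\<close>. So a Frobenius norm may be computed in any orthonormal
  basis, at the price of passing to the adjoint.\<close>

lemma sum_norm_orthonormal_basis:
  fixes f g :: "'a::euclidean_space \<Rightarrow> 'a"
  assumes "finite B" "span B = UNIV" "pairwise orthogonal B" "\<And>b. b \<in> B \<Longrightarrow> norm b = 1"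
    and adj: "\<And>x y. x \<bullet> f y = g x \<bullet> y"
  shows "(\<Sum>i\<in>Basis. (norm (f i))\<^sup>2) = (\<Sum>b\<in>B. (norm (g b))\<^sup>2)"
proof -
  have "(\<Sum>i\<in>Basis. (norm (f i))\<^sup>2) = (\<Sum>i\<in>Basis. \<Sum>b\<in>B. (b \<bullet> f i)\<^sup>2)"
    using orthonormal_parseval[OF assms(1-4)] by (simp add: inner_commute)
  also have "\<dots> = (\<Sum>b\<in>B. \<Sum>i\<in>Basis. (g b \<bullet> i)\<^sup>2)"
    by (subst sum.swap) (simp add: adj)
  also have "\<dots> = (\<Sum>b\<in>B. (norm (g b))\<^sup>2)"
    unfolding power2_norm_eq_inner euclidean_inner[of "g _" "g _"] by (simp add: power2_eq_square)
  finally show ?thesis .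
qed

text \<open>In the block basis of \<open>K\<close>, a pair \<open>b\<close>, \<open>p b\<close>
  carries a single entry of \<open>K\<close> up to sign, and \<open>dom\<close> bounds it by the
  mean of two diagonal entries of \<open>S\<close>. The diagonal entries are dominated by the full
  Frobenius norm of \<open>S\<close>.\<close>

lemma skew_dominated_by_symmetric:
  fixes K S :: "'a::euclidean_space \<Rightarrow> 'a"
  assumes "linear K" and skew: "\<And>x y. x \<bullet> K y = - (K x \<bullet> y)" and sym: "\<And>x y. x \<bullet> S y = S x \<bullet> y"
    and dom: "\<And>x y. norm x = 1 \<Longrightarrow> norm y = 1 \<Longrightarrow> x \<bullet> y = 0 \<Longrightarrow> 2 * (x \<bullet> K y) \<le> x \<bullet> S x + y \<bullet> S y"
  shows "(\<Sum>i\<in>Basis. (norm (K i))\<^sup>2) \<le> (\<Sum>i\<in>Basis. (norm (S i))\<^sup>2)"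
proof -
  obtain B p where B: "finite B" "span B = UNIV" "pairwise orthogonal B" "\<And>b. b \<in> B \<Longrightarrow> norm b = 1"
    and p: "\<And>b. b \<in> B \<Longrightarrow> p b \<in> B" "\<And>b. b \<in> B \<Longrightarrow> p (p b) = b"
      "\<And>b. b \<in> B \<Longrightarrow> K b = (K b \<bullet> p b) *\<^sub>R p b"
    using skew_normal_basis[OF assms(1) skew, of UNIV] by (auto, metis)
  have "(\<Sum>i\<in>Basis. (norm (K i))\<^sup>2) = (\<Sum>b\<in>B. (norm (- K b))\<^sup>2)"
    by (rule sum_norm_orthonormal_basis[OF B]) (auto simp: skew)
  also have "\<dots> \<le> (\<Sum>b\<in>B. ((b \<bullet> S b)\<^sup>2 + (p b \<bullet> S (p b))\<^sup>2) / 2)"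
  proof (rule sum_mono)
    fix b assume b: "b \<in> B"
    have "(norm (- K b))\<^sup>2 = (K b \<bullet> p b)\<^sup>2"
      using arg_cong[OF p(3)[OF b], of norm] B(4)[OF p(1)[OF b]] by simp
    also have "\<dots> \<le> ((b \<bullet> S b)\<^sup>2 + (p b \<bullet> S (p b))\<^sup>2) / 2"
    proof (cases "p b = b")
      case True
      then show ?thesis using skew[of b b] by (simp add: inner_commute)
    next
      case False
      let ?t = "p b \<bullet> K b" and ?q = "b \<bullet> S b + p b \<bullet> S (p b)"
      have nn: "norm b = 1" "norm (p b) = 1" using B(4) b p(1) by auto
      have orth: "p b \<bullet> b = 0"
        using False B(3) b p(1) by (auto simp: pairwise_def orthogonal_def)
      have "2 * ?t \<le> ?q" using dom[of "p b" b] nn orth by simp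
      \<comment> \<open>Exchanging the two vectors changes the sign of the skew term, so the bound
        holds for its absolute value.\<close>
      moreover have "- 2 * ?t \<le> ?q"
        using dom[of "b" "p b"] nn orth skew[of b "p b"] by (simp add: inner_commute)
      ultimately have "\<bar>2 * ?t\<bar> \<le> \<bar>?q\<bar>" by linarith
      then have "(2 * ?t)\<^sup>2 \<le> ?q\<^sup>2" by (simp add: abs_le_square_iff)
      moreover have "?q\<^sup>2 \<le> 2 * ((b \<bullet> S b)\<^sup>2 + (p b \<bullet> S (p b))\<^sup>2)"
        using sum_squares_bound[of "b \<bullet> S b" "p b \<bullet> S (p b)"] by (simp add: power2_sum)
      ultimately show ?thesis by (simp add: inner_commute power_mult_distrib)
    qed
    finally show "(norm (- K b))\<^sup>2 \<le> ((b \<bullet> S b)\<^sup>2 + (p b \<bullet> S (p b))\<^sup>2) / 2" .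
  qed
  also have "\<dots> = (\<Sum>b\<in>B. (b \<bullet> S b)\<^sup>2)"
  proof -
    \<comment> \<open>The involution \<open>p\<close> permutes \<open>B\<close>, so both halves of
      the mean have the same sum.\<close>
    have "(\<Sum>b\<in>B. (p b \<bullet> S (p b))\<^sup>2) = (\<Sum>b\<in>B. (b \<bullet> S b)\<^sup>2)"
      by (rule sum.reindex_bij_witness[of _ p p]) (auto simp: p)
    then show ?thesis by (simp add: sum.distrib flip: sum_divide_distrib)
  qed
  also have "\<dots> \<le> (\<Sum>b\<in>B. (norm (S b))\<^sup>2)"
  proof (rule sum_mono)
    fix b assume "b \<in> B"
    then have "\<bar>b \<bullet> S b\<bar> \<le> norm (S b)"
      using Cauchy_Schwarz_ineq2[of b "S b"] B(4) by simp
    then show "(b \<bullet> S b)\<^sup>2 \<le> (norm (S b))\<^sup>2"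
      by (metis abs_le_square_iff abs_norm_cancel)
  qed
  also have "\<dots> = (\<Sum>i\<in>Basis. (norm (S i))\<^sup>2)"
    by (rule sum_norm_orthonormal_basis[OF B, symmetric]) (auto simp: sym)
  finally show ?thesis .
qed

section \<open>Nonnegativity on isotropic vectors and the sum of squared entries\<close>

text \<open>Isotropy of \<open>x + i y\<close> means that \<open>x\<close> and \<open>y\<close> are
  orthogonal of equal length. With \<open>A = S + i T\<close>, the real part of the sum of squares
  is the difference of the squared Frobenius norms of \<open>S\<close> and \<open>T\<close>. The
  imaginary part is twice their inner product, which vanishes for \<open>S\<close> symmetric and
  \<open>T\<close> skew.\<close>

lemma isotropic_nonneg_imp_sum_squares_nonneg:
  fixes A :: "'n::finite \<Rightarrow> 'n \<Rightarrow> complex"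
  assumes card: "CARD('n) \<ge> 3"
    and nonneg: "\<And>z :: 'n \<Rightarrow> complex. (\<Sum>i\<in>UNIV. (z i)\<^sup>2) = 0 \<Longrightarrow>
      (\<Sum>i\<in>UNIV. \<Sum>j\<in>UNIV. A i j * z i * cnj (z j)) \<in> \<real>\<^sub>\<ge>\<^sub>0"
  shows "(\<Sum>i\<in>UNIV. \<Sum>j\<in>UNIV. (A i j)\<^sup>2) \<in> \<real>\<^sub>\<ge>\<^sub>0"
proof -
  define S :: "real^'n^'n" where "S = (\<chi> i j. Re (A i j))"
  define T :: "real^'n^'n" where "T = (\<chi> i j. Im (A i j))"
  have bil: "x \<bullet> (M *v y) = (\<Sum>i\<in>UNIV. \<Sum>j\<in>UNIV. M $ i $ j * x $ i * y $ j)"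
    for M :: "real^'n^'n" and x y
    by (simp add: inner_vec_def matrix_vector_mult_def sum_distrib_left mult_ac)
  have expand: "(\<Sum>i\<in>UNIV. \<Sum>j\<in>UNIV. A i j * Complex (x$i) (y$i) * cnj (Complex (x$j) (y$j))) =
     Complex (x \<bullet> (S *v x) + y \<bullet> (S *v y) + x \<bullet> (T *v y) - y \<bullet> (T *v x))
       (x \<bullet> (T *v x) + y \<bullet> (T *v y) + y \<bullet> (S *v x) - x \<bullet> (S *v y))" for x y
    by (rule complex_eqI)
       (simp_all add: bil S_def T_def sum.distrib[symmetric] sum_subtractf[symmetric] algebra_simps)
  have key: "x \<bullet> (S *v x) + y \<bullet> (S *v y) + x \<bullet> (T *v y) - y \<bullet> (T *v x) \<ge> 0 \<and>
      x \<bullet> (T *v x) + y \<bullet> (T *v y) + y \<bullet> (S *v x) - x \<bullet> (S *v y) = 0"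
    if "x \<bullet> x = y \<bullet> y" "x \<bullet> y = 0" for x y
  proof -
    have "(\<Sum>i\<in>UNIV. (Complex (x$i) (y$i))\<^sup>2) = Complex (x \<bullet> x - y \<bullet> y) (2 * (x \<bullet> y))"
      by (rule complex_eqI)
         (simp_all add: inner_vec_def sum_subtractf sum_distrib_left power2_eq_square)
    also have "\<dots> = 0" using that by (simp add: complex_eq_iff)
    finally show ?thesis using nonneg[of "\<lambda>i. Complex (x$i) (y$i)"]
      unfolding expand by (simp add: complex_nonneg_Reals_iff)
  qed
  \<comment> \<open>Replacing \<open>y\<close> by \<open>- y\<close> preserves the hypotheses and
    separates the terms of the vanishing imaginary part that are even in \<open>y\<close> from those
    that are odd.\<close>
  have key': "x \<bullet> (T *v x) + y \<bullet> (T *v y) = 0 \<and> y \<bullet> (S *v x) = x \<bullet> (S *v y)"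
    if "x \<bullet> x = y \<bullet> y" "x \<bullet> y = 0" for x y
  proof -
    have "M *v (- y) = - (M *v y)" for M :: "real^'n^'n"
      using linear_neg[OF matrix_vector_mul_linear] by blast
    then show ?thesis using key[of x y] key[of x "-y"] that by auto
  qed
  have ax: "axis i (a::real) \<bullet> (M *v axis j b) = a * b * M $ i $ j" for M :: "real^'n^'n" and i j a b
    by (simp add: inner_axis' matrix_vector_mult_def) (simp add: axis_def if_distrib cong: if_cong)
  have symS: "S $ i $ j = S $ j $ i" for i j
  proof (cases "i = j")
    case False
    then show ?thesis using key'[of "axis i 1" "axis j 1"] ax[of _ 1 _ _ 1]
      by (simp add: inner_axis_axis)
  qed simp
  have other: "\<exists>k. k \<noteq> i \<and> k \<noteq> j" for i j :: 'n
  proof (rule ccontr)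
    assume "\<nexists>k. k \<noteq> i \<and> k \<noteq> j"
    then have "UNIV = {i, j}" by auto
    then have "CARD('n) = card {i, j}" by (rule arg_cong)
    also have "\<dots> \<le> 2" by (simp add: card_insert_if)
    finally show False using card by simp
  qed
  have diag2: "T $ i $ i + T $ j $ j = 0" if "i \<noteq> j" for i j
    using that key'[of "axis i 1" "axis j 1"] ax[of _ 1 T _ 1]
    by (simp add: inner_axis_axis)
  \<comment> \<open>The pairwise sums over three distinct indices vanish, hence so does each
    diagonal entry.\<close>
  have diag: "T $ i $ i = 0" for i
  proof -
    obtain j where j: "j \<noteq> i" using other by blast
    obtain k where k: "k \<noteq> i" "k \<noteq> j" using other by blast
    show ?thesis using diag2[of i j] diag2[of i k] diag2[of j k] j k by auto
  qed
  have skewT: "T $ i $ j = - T $ j $ i" for i j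
  proof (cases "i = j")
    case False
    obtain k where k: "k \<noteq> i" "k \<noteq> j" using other by blast
    \<comment> \<open>The triple 3, 4, 5 gives an off-axis vector as long as \<open>axis k 5\<close>
      without square roots. As the diagonal of \<open>T\<close> is zero, only the mixed term
      survives.\<close>
    have "(axis i 3 + axis j 4) \<bullet> (T *v (axis i 3 + axis j 4)) + axis k 5 \<bullet> (T *v axis k 5) = 0"
      using False k by (intro conjunct1[OF key'])
         (simp_all add: inner_add_left inner_add_right inner_axis_axis)
    then have "12 * (T $ i $ j + T $ j $ i) = 0"
      by (simp add: inner_add_left inner_add_right matrix_vector_right_distrib ax diag algebra_simps)
    then show ?thesis by simp
  qed (simp add: diag)
  have symS': "x \<bullet> (S *v y) = (S *v x) \<bullet> y" for x y
    by (subst inner_commute[of "S *v x"], unfold bil, subst sum.swap) (simp add: symS mult_ac)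
  have skewT': "x \<bullet> (T *v y) = - ((T *v x) \<bullet> y)" for x y
    by (subst inner_commute[of "T *v x"], unfold bil, subst sum.swap, subst skewT)
       (simp add: sum_negf mult_ac)
  \<comment> \<open>The vectors enter \<open>key\<close> in the order \<open>y\<close>,
    \<open>x\<close>; skewness then merges its two mixed terms into one with the required
    sign.\<close>
  have "2 * (x \<bullet> (T *v y)) \<le> x \<bullet> (S *v x) + y \<bullet> (S *v y)"
    if "norm x = 1" "norm y = 1" "x \<bullet> y = 0" for x y
    using key[of y x] that skewT'[of y x] by (simp add: norm_eq_1 inner_commute)
  then have "(\<Sum>i\<in>Basis. (norm (T *v i))\<^sup>2) \<le> (\<Sum>i\<in>Basis. (norm (S *v i))\<^sup>2)"
    by (intro skew_dominated_by_symmetric skewT' symS' matrix_vector_mul_linear)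
  moreover have "(\<Sum>i\<in>Basis. (norm (M *v i))\<^sup>2) = (\<Sum>i\<in>UNIV. \<Sum>j\<in>UNIV. (M $ i $ j)\<^sup>2)" for M :: "real^'n^'n"
  proof -
    have "(\<Sum>i\<in>Basis. (norm (M *v i))\<^sup>2) = (\<Sum>j\<in>UNIV. (norm (M *v axis j 1))\<^sup>2)"
    proof (rule sum.reindex_cong[symmetric, of "\<lambda>j. axis j 1" , symmetric])
      show "inj (\<lambda>j. axis j (1::real))" by (auto simp: inj_def axis_eq_axis)
      show "Basis = range (\<lambda>j. axis j (1::real))" by (auto simp: Basis_vec_def)
    qed simp
    also have "\<dots> = (\<Sum>j\<in>UNIV. \<Sum>i\<in>UNIV. (M $ i $ j)\<^sup>2)"
      unfolding power2_norm_eq_inner by (simp add: inner_vec_def matrix_vector_mult_def axis_def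
          if_distrib power2_eq_square cong: if_cong)
    finally show ?thesis by (subst sum.swap) 
  qed
  ultimately have le: "(\<Sum>i\<in>UNIV. \<Sum>j\<in>UNIV. (T $ i $ j)\<^sup>2) \<le> (\<Sum>i\<in>UNIV. \<Sum>j\<in>UNIV. (S $ i $ j)\<^sup>2)"
    by simp
  \<comment> \<open>Transposing the indices keeps \<open>S\<close> and negates \<open>T\<close>, so
    the sum equals its own negative.\<close>
  have "(\<Sum>i\<in>UNIV. \<Sum>j\<in>UNIV. S $ i $ j * T $ i $ j) = (\<Sum>i\<in>UNIV. \<Sum>j\<in>UNIV. S $ j $ i * T $ j $ i)"
    by (rule sum.swap)
  also have "\<dots> = - (\<Sum>i\<in>UNIV. \<Sum>j\<in>UNIV. S $ i $ j * T $ i $ j)"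
  proof -
    have "S $ j $ i * T $ j $ i = - (S $ i $ j * T $ i $ j)" for i j
      using symS[of i j] skewT[of i j] by simp
    then have "(\<Sum>i\<in>UNIV. \<Sum>j\<in>UNIV. S $ j $ i * T $ j $ i) = (\<Sum>i\<in>UNIV. \<Sum>j\<in>UNIV. - (S $ i $ j * T $ i $ j))"
      by (intro sum.cong refl)
    then show ?thesis by (simp add: sum_negf)
  qed
  finally have cross: "(\<Sum>i\<in>UNIV. \<Sum>j\<in>UNIV. S $ i $ j * T $ i $ j) = 0" by simp
  have "Im (\<Sum>i\<in>UNIV. \<Sum>j\<in>UNIV. (A i j)\<^sup>2) = 2 * (\<Sum>i\<in>UNIV. \<Sum>j\<in>UNIV. S $ i $ j * T $ i $ j)"
    by (simp add: S_def T_def sum_distrib_left power2_eq_square mult_ac)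
  moreover have "Re (\<Sum>i\<in>UNIV. \<Sum>j\<in>UNIV. (A i j)\<^sup>2)
      = (\<Sum>i\<in>UNIV. \<Sum>j\<in>UNIV. (S $ i $ j)\<^sup>2) - (\<Sum>i\<in>UNIV. \<Sum>j\<in>UNIV. (T $ i $ j)\<^sup>2)"
    by (simp add: S_def T_def sum_subtractf power2_eq_square)
  ultimately show ?thesis using le cross by (simp add: complex_nonneg_Reals_iff)
qed

section \<open>The exterior algebra as a ring\<close>

lemma finite_inversions: "finite A \<Longrightarrow> finite B \<Longrightarrow> finite {(a, b). a \<in> A \<and> b \<in> B \<and> b < (a::nat)}"
  by (rule finite_subset[of _ "A \<times> B"]) auto

text \<open>Each inversion starts in exactly one of the two disjoint parts. This and its mirror
  image reduce the signs of triple products to signs of pairs of blocks.\<close>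

lemma shuffle_sign_union_left:
  assumes "finite A" "finite B" "finite C" "A \<inter> B = {}"
  shows "shuffle_sign (A \<union> B) C = shuffle_sign A C * shuffle_sign B C"
proof -
  have "{(a, b). a \<in> A \<union> B \<and> b \<in> C \<and> b < a} =
      {(a, b). a \<in> A \<and> b \<in> C \<and> b < a} \<union> {(a, b). a \<in> B \<and> b \<in> C \<and> b < a}" by auto
  moreover have "{(a, b). a \<in> A \<and> b \<in> C \<and> b < a} \<inter> {(a, b). a \<in> B \<and> b \<in> C \<and> b < a} = {}"
    using assms(4) by auto
  ultimately show ?thesis using finite_inversions assms
    by (simp add: shuffle_sign_def card_Un_disjoint power_add)
qed

lemma shuffle_sign_union_right:
  assumes "finite A" "finite B" "finite C" "B \<inter> C = {}"
  shows "shuffle_sign A (B \<union> C) = shuffle_sign A B * shuffle_sign A C"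
proof -
  have "{(a, b). a \<in> A \<and> b \<in> B \<union> C \<and> b < a} =
      {(a, b). a \<in> A \<and> b \<in> B \<and> b < a} \<union> {(a, b). a \<in> A \<and> b \<in> C \<and> b < a}" by auto
  moreover have "{(a, b). a \<in> A \<and> b \<in> B \<and> b < a} \<inter> {(a, b). a \<in> A \<and> b \<in> C \<and> b < a} = {}"
    using assms(4) by auto
  ultimately show ?thesis using finite_inversions assms
    by (simp add: shuffle_sign_def card_Un_disjoint power_add)
qed

lemma shuffle_sign_empty [simp]: "shuffle_sign {} B = 1" "shuffle_sign A {} = 1"
  by (simp_all add: shuffle_sign_def)

lemma wedge_apply: "wedge a b (I, J) = (\<Sum>I1\<in>Pow I. \<Sum>J1\<in>Pow J.
      (-1) ^ (card J1 * card (I - I1)) * shuffle_sign I1 (I - I1) * shuffle_sign J1 (J - J1)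
      * a (I1, J1) * b (I - I1, J - J1))"
  by (simp add: wedge_def)

text \<open>An infinite set has infinitely many subsets, and a sum over an infinite set is 0 by
  convention.\<close>

lemma wedge_infinite: "\<not> (finite I \<and> finite J) \<Longrightarrow> wedge a b (I, J) = 0"
  by (auto simp: wedge_apply)

text \<open>Both sides run over the ordered partitions of \<open>I\<close> into three blocks, empty
  ones allowed. On the left the first two blocks are chosen in turn; on the right their union
  \<open>Z\<close> is chosen first and then split.\<close>

lemma sum_Pow_Pow_swap:
  fixes f :: "'a set \<Rightarrow> 'a set \<Rightarrow> 'a set \<Rightarrow> 'b::comm_monoid_add"
  assumes "finite I"
  shows "(\<Sum>X\<in>Pow I. \<Sum>Y\<in>Pow (I - X). f X Y (I - X - Y)) = (\<Sum>Z\<in>Pow I. \<Sum>X\<in>Pow Z. f X (Z - X) (I - Z))"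
proof -
  have "(\<Sum>X\<in>Pow I. \<Sum>Y\<in>Pow (I - X). f X Y (I - X - Y)) =
      (\<Sum>(X, Y)\<in>(SIGMA X:Pow I. Pow (I - X)). f X Y (I - X - Y))"
    using assms by (simp add: sum.Sigma)
  also have "\<dots> = (\<Sum>(Z, X)\<in>(SIGMA Z:Pow I. Pow Z). f X (Z - X) (I - Z))"
    by (rule sum.reindex_bij_witness[of _ "\<lambda>(Z, X). (X, Z - X)" "\<lambda>(X, Y). (X \<union> Y, X)"])
       (auto simp: Un_Diff intro!: arg_cong3[of _ _ _ _ _ _ f])
  also have "\<dots> = (\<Sum>Z\<in>Pow I. \<Sum>X\<in>Pow Z. f X (Z - X) (I - Z))"
    using assms finite_subset by (subst sum.Sigma) auto
  finally show ?thesis .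
qed

lemma wedge_assoc: "wedge (wedge a b) c = wedge a (wedge b c)"
proof (rule ext, clarify)
  fix I J :: "nat set"
  show "wedge (wedge a b) c (I, J) = wedge a (wedge b c) (I, J)"
  proof (cases "finite I \<and> finite J")
    case True
    then have fI: "finite I" and fJ: "finite J" by auto
    \<comment> \<open>The common summand of both bracketings. Its sign has a shuffle factor for each
      pair of blocks of \<open>I\<close> and of \<open>J\<close>, and a factor for moving each
      earlier block of \<open>J\<close> past each later block of \<open>I\<close>.\<close>
    define s :: "nat set \<Rightarrow> nat set \<Rightarrow> nat set \<Rightarrow> nat set \<Rightarrow> nat set \<Rightarrow> nat set \<Rightarrow> complex" where
      "s X Y Z U V W = (-1) ^ (card U * card Y + card U * card Z + card V * card Z)
        * (shuffle_sign X Y * shuffle_sign X Z * shuffle_sign Y Z)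
        * (shuffle_sign U V * shuffle_sign U W * shuffle_sign V W)
        * a (X, U) * b (Y, V) * c (Z, W)" for X Y Z U V W
    have "wedge a (wedge b c) (I, J) = (\<Sum>X\<in>Pow I. \<Sum>U\<in>Pow J. \<Sum>Y\<in>Pow (I - X). \<Sum>V\<in>Pow (J - U).
        s X Y (I - X - Y) U V (J - U - V))"
      unfolding wedge_apply sum_distrib_left
    proof (intro sum.cong refl)
      fix X U Y V assume XU: "X \<in> Pow I" "U \<in> Pow J" "Y \<in> Pow (I - X)" "V \<in> Pow (J - U)"
      define Z where "Z = I - X - Y"
      define W where "W = J - U - V"
      have "finite X" "finite U" "finite Y" "finite V" "finite Z" "finite W"
        using XU fI fJ by (auto simp: Z_def W_def intro: finite_subset)
      moreover have "I - X = Y \<union> Z" "J - U = V \<union> W" "Y \<inter> Z = {}" "V \<inter> W = {}"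
        using XU by (auto simp: Z_def W_def)
      ultimately show "(-1) ^ (card U * card (I - X)) * shuffle_sign X (I - X) * shuffle_sign U (J - U)
          * a (X, U) * ((-1) ^ (card V * card (I - X - Y)) * shuffle_sign Y (I - X - Y)
          * shuffle_sign V (J - U - V) * b (Y, V) * c (I - X - Y, J - U - V))
        = s X Y (I - X - Y) U V (J - U - V)"
        unfolding Z_def[symmetric] W_def[symmetric]
        by (simp add: s_def shuffle_sign_union_right card_Un_disjoint power_add distrib_left mult_ac)
    qed
    also have "\<dots> = (\<Sum>X\<in>Pow I. \<Sum>Y\<in>Pow (I - X). \<Sum>U\<in>Pow J. \<Sum>V\<in>Pow (J - U).
        s X Y (I - X - Y) U V (J - U - V))"
      by (rule sum.cong[OF refl], rule sum.swap)
    also have "\<dots> = (\<Sum>P\<in>Pow I. \<Sum>X\<in>Pow P. \<Sum>R\<in>Pow J. \<Sum>U\<in>Pow R. s X (P - X) (I - P) U (R - U) (J - R))"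
      unfolding sum_Pow_Pow_swap[OF fJ] 
      by (rule sum_Pow_Pow_swap[OF fI, of "\<lambda>X Y Z. \<Sum>R\<in>Pow J. \<Sum>U\<in>Pow R. s X Y Z U (R - U) (J - R)"])
    also have "\<dots> = (\<Sum>P\<in>Pow I. \<Sum>R\<in>Pow J. \<Sum>X\<in>Pow P. \<Sum>U\<in>Pow R. s X (P - X) (I - P) U (R - U) (J - R))"
      by (rule sum.cong[OF refl], rule sum.swap)
    also have "\<dots> = wedge (wedge a b) c (I, J)"
      unfolding wedge_apply sum_distrib_left sum_distrib_right
    proof (intro sum.cong refl)
      fix P R X U assume PR: "P \<in> Pow I" "R \<in> Pow J" "X \<in> Pow P" "U \<in> Pow R"
      define Y where "Y = P - X"
      define V where "V = R - U"
      define Z where "Z = I - P"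
      define W where "W = J - R"
      have "finite X" "finite U" "finite Y" "finite V" "finite Z" "finite W"
        using PR fI fJ unfolding Y_def V_def Z_def W_def
        by (meson PowD finite_Diff finite_subset)+
      moreover have "P = X \<union> Y" "R = U \<union> V" "X \<inter> Y = {}" "U \<inter> V = {}"
        using PR by (auto simp: Y_def V_def)
      ultimately have "s X Y Z U V W
        = (-1) ^ (card R * card Z) * shuffle_sign P Z * shuffle_sign R W
          * ((-1) ^ (card U * card Y) * shuffle_sign X Y * shuffle_sign U V * a (X, U) * b (Y, V)) * c (Z, W)"
        by (simp add: s_def shuffle_sign_union_left card_Un_disjoint power_add distrib_left distrib_right mult_ac)
      then show "s X (P - X) (I - P) U (R - U) (J - R)
        = (-1) ^ (card R * card (I - P)) * shuffle_sign P (I - P) * shuffle_sign R (J - R)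
          * ((-1) ^ (card U * card (P - X)) * shuffle_sign X (P - X) * shuffle_sign U (R - U)
            * a (X, U) * b (P - X, R - U)) * c (I - P, J - R)"
        by (simp add: Y_def V_def Z_def W_def)
    qed
    finally show ?thesis by simp
  qed (simp add: wedge_infinite)
qed

text \<open>No dimension or degree is fixed, so that all forms live in one ring. Coefficients at
  infinite index sets must vanish, since multiplication by \<open>form_one\<close> would otherwise
  change them.\<close>

typedef ext = "{a :: form. \<forall>I J. \<not> (finite I \<and> finite J) \<longrightarrow> a (I, J) = 0}"
  morphisms form_of to_ext
  by (rule exI[of _ "\<lambda>_. 0"]) simp

setup_lifting type_definition_ext

instantiation ext :: ring_1
begin

lift_definition zero_ext :: ext is "\<lambda>_. 0" by simp
lift_definition one_ext :: ext is form_one by (auto simp: form_one_def)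
lift_definition plus_ext :: "ext \<Rightarrow> ext \<Rightarrow> ext" is "\<lambda>a b x. a x + b x" by simp
lift_definition minus_ext :: "ext \<Rightarrow> ext \<Rightarrow> ext" is "\<lambda>a b x. a x - b x" by simp
lift_definition uminus_ext :: "ext \<Rightarrow> ext" is "\<lambda>a x. - a x" by simp
lift_definition times_ext :: "ext \<Rightarrow> ext \<Rightarrow> ext" is wedge using wedge_infinite by blast

instance
proof
  fix a b c :: ext
  show "a + b + c = a + (b + c)" by transfer (simp add: fun_eq_iff)
  show "a + b = b + a" by transfer (simp add: fun_eq_iff)
  show "0 + a = a" by transfer simp
  show "- a + a = 0" by transfer simp
  show "a - b = a + - b" by transfer simp
  show "a * b * c = a * (b * c)" by transfer (rule wedge_assoc)
  show "(a + b) * c = a * c + b * c"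
    by transfer (auto simp: fun_eq_iff wedge_apply algebra_simps sum.distrib)
  show "a * (b + c) = a * b + a * c"
    by transfer (auto simp: fun_eq_iff wedge_apply algebra_simps sum.distrib)
  show "(0::ext) \<noteq> 1"
    by transfer (auto simp: form_one_def fun_eq_iff)
  show "1 * a = a"
  proof (transfer, rule ext, clarify)
    fix a :: form and I J :: "nat set"
    assume a: "\<forall>I J. \<not> (finite I \<and> finite J) \<longrightarrow> a (I, J) = 0"
    show "wedge form_one a (I, J) = a (I, J)"
    proof (cases "finite I \<and> finite J")
      case True
      have "wedge form_one a (I, J) = (\<Sum>I1\<in>Pow I. if I1 = {} then
          (\<Sum>J1\<in>Pow J. if J1 = {} then a (I, J) else 0) else 0)"
        unfolding wedge_apply by (intro sum.cong refl) (auto simp: form_one_def intro!: sum.cong)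
      then show ?thesis using True by simp
    qed (use a in \<open>auto simp: wedge_infinite\<close>)
  qed
  show "a * 1 = a"
  proof (transfer, rule ext, clarify)
    fix a :: form and I J :: "nat set"
    assume a: "\<forall>I J. \<not> (finite I \<and> finite J) \<longrightarrow> a (I, J) = 0"
    show "wedge a form_one (I, J) = a (I, J)"
    proof (cases "finite I \<and> finite J")
      case True
      have "wedge a form_one (I, J) = (\<Sum>I1\<in>Pow I. if I1 = I then
          (\<Sum>J1\<in>Pow J. if J1 = J then a (I, J) else 0) else 0)"
        unfolding wedge_apply by (intro sum.cong refl) (auto simp: form_one_def intro!: sum.cong)
      then show ?thesis using True by simp
    qed (use a in \<open>auto simp: wedge_infinite\<close>)
  qed
qed

end

section \<open>Scalars, monomials and generators\<close>

lift_definition cscale :: "complex \<Rightarrow> ext \<Rightarrow> ext" (infixr "*\<^sub>C" 75) is scale_form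
  by (simp add: scale_form_def)

interpretation ext: vector_space cscale
  by standard (transfer, simp add: scale_form_def algebra_simps)+

lemma cscale_mult_left [simp]: "(c *\<^sub>C x) * y = c *\<^sub>C (x * y)"
  by transfer (auto simp: fun_eq_iff scale_form_def wedge_apply sum_distrib_left mult_ac)

lemma cscale_mult_right [simp]: "x * (c *\<^sub>C y) = c *\<^sub>C (x * y)"
  by transfer (auto simp: fun_eq_iff scale_form_def wedge_apply sum_distrib_left mult_ac)

lift_definition monomial :: "nat set \<Rightarrow> nat set \<Rightarrow> ext" is
  "\<lambda>A B x. if finite A \<and> finite B \<and> x = (A, B) then 1 else 0" by auto

lemma form_of_monomial:
  "form_of (monomial A B) (I, J) = (if finite A \<and> finite B \<and> I = A \<and> J = B then 1 else 0)"
  by transfer auto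

lemma monomial_mult:
  assumes fin: "finite A" "finite B" "finite C" "finite D"
  shows "monomial A B * monomial C D = (if A \<inter> C = {} \<and> B \<inter> D = {} then
    ((-1) ^ (card B * card C) * shuffle_sign A C * shuffle_sign B D) *\<^sub>C monomial (A \<union> C) (B \<union> D) else 0)"
proof (intro form_of_inject[THEN iffD1] HOL.ext, clarify)
  fix I J
  have "form_of (monomial A B * monomial C D) (I, J) = wedge (form_of (monomial A B)) (form_of (monomial C D)) (I, J)"
    by (simp add: times_ext.rep_eq)
  also have "\<dots> = (if A \<subseteq> I \<and> B \<subseteq> J \<and> finite I \<and> finite J \<and> I - A = C \<and> J - B = D then
        (-1) ^ (card B * card C) * shuffle_sign A C * shuffle_sign B D else 0)"
  proof (cases "finite I \<and> finite J")
    case True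
    have "wedge (form_of (monomial A B)) (form_of (monomial C D)) (I, J) = (\<Sum>I1\<in>Pow I. \<Sum>J1\<in>Pow J.
        if J1 = B then (if I1 = A then (if I - A = C \<and> J - B = D then
        (-1) ^ (card B * card C) * shuffle_sign A C * shuffle_sign B D else 0) else 0) else 0)"
      unfolding wedge_apply by (intro sum.cong refl) (auto simp: form_of_monomial fin)
    then show ?thesis using True by (cases "B \<subseteq> J") simp_all
  qed (auto simp: wedge_infinite)
  also have "\<dots> = (if A \<inter> C = {} \<and> B \<inter> D = {} \<and> I = A \<union> C \<and> J = B \<union> D then
        (-1) ^ (card B * card C) * shuffle_sign A C * shuffle_sign B D else 0)"
  proof -
    have "A \<subseteq> I \<and> B \<subseteq> J \<and> finite I \<and> finite J \<and> I - A = C \<and> J - B = D \<longleftrightarrow>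
      A \<inter> C = {} \<and> B \<inter> D = {} \<and> I = A \<union> C \<and> J = B \<union> D"
      using fin by (auto intro: finite_subset[of I "A \<union> C"])
    then show ?thesis by simp
  qed
  also have "\<dots> = form_of (if A \<inter> C = {} \<and> B \<inter> D = {} then
    ((-1) ^ (card B * card C) * shuffle_sign A C * shuffle_sign B D) *\<^sub>C monomial (A \<union> C) (B \<union> D) else 0) (I, J)"
    using fin by (auto simp: cscale.rep_eq scale_form_def form_of_monomial zero_ext.rep_eq)
  finally show "form_of (monomial A B * monomial C D) (I, J) = form_of (if A \<inter> C = {} \<and> B \<inter> D = {} then
    ((-1) ^ (card B * card C) * shuffle_sign A C * shuffle_sign B D) *\<^sub>C monomial (A \<union> C) (B \<union> D) else 0) (I, J)" .
qed

definition dz :: "nat \<Rightarrow> ext" where "dz i = monomial {i} {}"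
definition dzb :: "nat \<Rightarrow> ext" where "dzb i = monomial {} {i}"

lemma shuffle_sign_singletons: "shuffle_sign {i} {j} = (if j < i then -1 else 1)"
proof -
  have "{(a, b). a \<in> {i} \<and> b \<in> {j} \<and> b < a} = (if j < i then {(i, j)} else {})" by auto
  then show ?thesis by (simp add: shuffle_sign_def)
qed

lemma dz_anticommute: "dz i * dz j = - (dz j * dz i)"
  by (auto simp: dz_def monomial_mult shuffle_sign_singletons insert_commute)

lemma dzb_anticommute: "dzb i * dzb j = - (dzb j * dzb i)"
  by (auto simp: dzb_def monomial_mult shuffle_sign_singletons insert_commute)

lemma dz_dzb_anticommute: "dzb i * dz j = - (dz j * dzb i)"
  by (auto simp: dz_def dzb_def monomial_mult)

lemma dz_square: "dz i * dz i = 0" and dzb_square: "dzb i * dzb i = 0"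
  by (simp_all add: dz_def dzb_def monomial_mult)

lemma form_of_sum: "form_of (sum f A) x = (\<Sum>i\<in>A. form_of (f i) x)"
  by (induction A rule: infinite_finite_induct) (simp_all add: zero_ext.rep_eq plus_ext.rep_eq)

definition hol :: "nat \<Rightarrow> (nat \<Rightarrow> complex) \<Rightarrow> ext" where
  "hol n c = (\<Sum>i<n. c i *\<^sub>C dz i)"
definition ahol :: "nat \<Rightarrow> (nat \<Rightarrow> complex) \<Rightarrow> ext" where
  "ahol n c = (\<Sum>i<n. cnj (c i) *\<^sub>C dzb i)"

lemma form_of_hol: "form_of (hol n c) = form10 n c"
proof (rule HOL.ext, clarify)
  fix I J
  show "form_of (hol n c) (I, J) = form10 n c (I, J)"
  proof (cases "J = {} \<and> (\<exists>j<n. I = {j})")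
    case True
    then obtain j where "j < n" "I = {j}" "J = {}" by blast
    then show ?thesis
      by (simp add: hol_def form10_def form_of_sum cscale.rep_eq scale_form_def dz_def form_of_monomial
          if_distrib cong: if_cong)
  next
    case False
    then show ?thesis
      by (auto simp: hol_def form10_def form_of_sum cscale.rep_eq scale_form_def dz_def form_of_monomial
          intro!: sum.neutral)
  qed
qed

lemma form_of_ahol: "form_of (ahol n c) = form10_conj n c"
proof (rule HOL.ext, clarify)
  fix I J
  show "form_of (ahol n c) (I, J) = form10_conj n c (I, J)"
  proof (cases "I = {} \<and> (\<exists>j<n. J = {j})")
    case True
    then obtain j where "j < n" "J = {j}" "I = {}" by blast
    then show ?thesis
      by (simp add: ahol_def form10_conj_def form_of_sum cscale.rep_eq scale_form_def dzb_def form_of_monomial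
          if_distrib cong: if_cong)
  next
    case False
    then show ?thesis
      by (auto simp: ahol_def form10_conj_def form_of_sum cscale.rep_eq scale_form_def dzb_def form_of_monomial
          intro!: sum.neutral)
  qed
qed

definition omega :: "nat \<Rightarrow> (nat \<Rightarrow> complex) \<Rightarrow> ext" where
  "omega n c = \<i> *\<^sub>C (hol n c * ahol n c)"

fun sp :: "nat \<Rightarrow> (nat \<Rightarrow> nat \<Rightarrow> complex) \<Rightarrow> nat \<Rightarrow> ext" where
  "sp n g 0 = 1"
| "sp n g (Suc m) = sp n g m * omega n (g m)"

lemma form_of_sp: "form_of (sp n g m) = sp_prod n g m"
  by (induction m)
     (simp_all add: one_ext.rep_eq times_ext.rep_eq omega_def cscale.rep_eq form_of_hol form_of_ahol
       del: cscale_mult_right)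

lemma sp_cong: "(\<And>k. k < m \<Longrightarrow> g k = h k) \<Longrightarrow> sp n g m = sp n h m"
  by (induction m) auto


section \<open>One-forms and the elements commuting with them\<close>

definition one_forms :: "ext set" where
  "one_forms = ext.span (range dz \<union> range dzb)"

lemma one_form_anticommute:
  assumes "x \<in> one_forms" "y \<in> one_forms"
  shows "x * y = - (y * x)"
proof -
  have gen: "u * v = - (v * u)" if "u \<in> range dz \<union> range dzb" "v \<in> range dz \<union> range dzb" for u v
    using that dz_anticommute dzb_anticommute dz_dzb_anticommute
    by (auto simp: minus_equation_iff)
  have gen': "u * y = - (y * u)" if "u \<in> range dz \<union> range dzb" for u
    using assms(2) unfolding one_forms_def
  proof (induction rule: ext.span_induct_alt)
    case (step c v w)
    then show ?case using gen[OF that step(1)] by (simp add: algebra_simps)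
  qed simp
  show ?thesis using assms(1) unfolding one_forms_def
  proof (induction rule: ext.span_induct_alt)
    case (step c v w)
    then show ?case using gen'[OF step(1)] by (simp add: algebra_simps)
  qed simp
qed

lemma double_eq_0_ext: "x + x = 0 \<Longrightarrow> x = 0" for x :: ext
  by transfer (simp add: fun_eq_iff)

lemma one_form_square: "x \<in> one_forms \<Longrightarrow> x * x = 0"
  using one_form_anticommute[of x x] double_eq_0_ext by (metis add.right_inverse)

lemma one_formsI [simp, intro]:
  "dz i \<in> one_forms" "dzb i \<in> one_forms"
  "(\<And>i. i \<in> A \<Longrightarrow> f i \<in> one_forms) \<Longrightarrow> sum f A \<in> one_forms"
  "x \<in> one_forms \<Longrightarrow> c *\<^sub>C x \<in> one_forms"
  "x \<in> one_forms \<Longrightarrow> y \<in> one_forms \<Longrightarrow> x + y \<in> one_forms"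
  unfolding one_forms_def
  by (auto intro: ext.span_base ext.span_sum ext.span_scale ext.span_add)

lemma hol_one_form [simp]: "hol n c \<in> one_forms" and ahol_one_form [simp]: "ahol n c \<in> one_forms"
  by (auto simp: hol_def ahol_def)

text \<open>A substitute for even degree: it is inherited by sums and products and holds for
  products of two one-forms, so no grading has to be carried along.\<close>

definition commutes :: "ext \<Rightarrow> bool" where
  "commutes x \<longleftrightarrow> (\<forall>u\<in>one_forms. x * u = u * x)"

lemma commutesD: "commutes x \<Longrightarrow> u \<in> one_forms \<Longrightarrow> x * u = u * x"
  by (simp add: commutes_def)

lemma commutes_1 [simp]: "commutes 1"
  by (simp add: commutes_def)

lemma commutes_add [simp]: "commutes x \<Longrightarrow> commutes y \<Longrightarrow> commutes (x + y)"
  and commutes_diff [simp]: "commutes x \<Longrightarrow> commutes y \<Longrightarrow> commutes (x - y)"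
  and commutes_cscale [simp]: "commutes x \<Longrightarrow> commutes (c *\<^sub>C x)"
  by (simp_all add: commutes_def algebra_simps)

lemma commutes_mult [simp]: "commutes x \<Longrightarrow> commutes y \<Longrightarrow> commutes (x * y)"
  unfolding commutes_def by (metis mult.assoc)

text \<open>Passing a one-form across two others produces two signs, which cancel.\<close>

lemma commutes_pair [simp]:
  assumes "x \<in> one_forms" "y \<in> one_forms"
  shows "commutes (x * y)"
  unfolding commutes_def
proof
  fix u assume u: "u \<in> one_forms"
  have "x * y * u = - (x * u * y)"
    using one_form_anticommute[OF assms(2) u] by (simp add: mult.assoc)
  also have "\<dots> = u * (x * y)"
    using one_form_anticommute[OF assms(1) u] by (simp add: mult.assoc[symmetric])
  finally show "x * y * u = u * (x * y)" .
qed

lemma commutes_omega [simp]: "commutes (omega n c)"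
  by (simp add: omega_def)

lemma commutes_sp [simp]: "commutes (sp n g m)"
  by (induction m) simp_all

lemma commutes_swap:
  assumes "commutes z" "x \<in> one_forms" "y \<in> one_forms"
  shows "z * (x * y) = (x * y) * z"
  by (metis assms commutesD mult.assoc)

section \<open>Exchange of coordinates modulo an annihilator\<close>

definition om :: "nat \<Rightarrow> ext" where
  "om s = \<i> *\<^sub>C (dz s * dzb s)"

text \<open>The coordinate covectors, so that \<open>sp n delta n\<close> is the volume form inside
  \<open>ext\<close>.\<close>

definition delta :: "nat \<Rightarrow> nat \<Rightarrow> complex" where
  "delta k = (\<lambda>j. if j = k then 1 else 0)"

lemma omega_delta: "s < n \<Longrightarrow> omega n (delta s) = om s"
  by (simp add: omega_def om_def hol_def ahol_def delta_def if_distrib[of "\<lambda>c. c *\<^sub>C _"] if_distrib[of cnj]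
      cong: if_cong)

lemma commutes_om [simp]: "commutes (om s)"
  by (simp add: om_def)

lemma commutes_prod_om [simp]: "commutes (prod_list (map om L))"
  by (induction L) simp_all

lemma commutes_swap_om:
  assumes "commutes z" shows "z * om s = om s * z"
  using commutes_swap[OF assms, of "dz s" "dzb s"] by (simp add: om_def)

lemma prod_om_eq_sp: "m \<le> n \<Longrightarrow> prod_list (map om [0..<m]) = sp n delta m"
  by (induction m) (simp_all add: omega_delta)

text \<open>The one-form slides past the other \<open>om\<close> factors, which commute with it,
  until it meets \<open>om s\<close>, where a repeated generator gives zero.\<close>

lemma dz_prod_om: "s \<in> set L \<Longrightarrow> dz s * prod_list (map om L) = 0"
  and dzb_prod_om: "s \<in> set L \<Longrightarrow> dzb s * prod_list (map om L) = 0"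
proof -
  have 1: "dz s * om s = 0" by (simp add: om_def mult.assoc[symmetric] dz_square)
  have 2: "dzb s * om s = 0"
    using dz_dzb_anticommute[of s s]
    by (simp add: om_def mult.assoc[symmetric]) (simp add: mult.assoc dzb_square)
  have "x * prod_list (map om L) = 0" if s: "s \<in> set L" and x: "x * om s = 0" "x \<in> one_forms" for x
    using s
  proof (induction L)
    case (Cons a L)
    show ?case
    proof (cases "s = a")
      case True
      with x(1) show ?thesis by (simp add: mult.assoc[symmetric])
    next
      case False
      then have "om a * x * prod_list (map om L) = 0" using Cons by (simp add: mult.assoc)
      then show ?thesis using commutesD[OF commutes_om x(2)] by (simp add: mult.assoc[symmetric])
    qed
  qed simp
  then show "s \<in> set L \<Longrightarrow> dz s * prod_list (map om L) = 0" "s \<in> set L \<Longrightarrow> dzb s * prod_list (map om L) = 0"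
    using 1 2 by auto
qed

text \<open>
  Steinitz exchange carried out modulo the annihilator of \<open>sp n g m\<close>: each new covector replaces one
  \<open>dz\<^sub>s\<close>. The product with the remaining \<open>om s\<close> changes by the squared modulus of the pivot
  coefficient, which keeps it a nonnegative multiple of the volume form.
\<close>

lemma sp_exchange:
  assumes "m \<le> n"
  shows "sp n g m = 0 \<or> (\<exists>L t. length L = n - m \<and> distinct L \<and> set L \<subseteq> {..<n} \<and> (t::real) \<ge> 0 \<and>
    sp n g m * prod_list (map om L) = complex_of_real t *\<^sub>C sp n delta n \<and>
    (\<forall>i<n. \<exists>b. dz i * sp n g m = (\<Sum>s\<in>set L. b s *\<^sub>C dz s) * sp n g m \<and>
               dzb i * sp n g m = (\<Sum>s\<in>set L. cnj (b s) *\<^sub>C dzb s) * sp n g m))"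
  using assms
proof (induction m)
  case 0
  have "\<exists>b. dz i = (\<Sum>s\<in>{..<n}. b s *\<^sub>C dz s) \<and> dzb i = (\<Sum>s\<in>{..<n}. cnj (b s) *\<^sub>C dzb s)" if "i < n" for i
    by (rule exI[of _ "delta i"]) (use that in \<open>simp add: delta_def if_distrib[of "\<lambda>c. c *\<^sub>C _"] if_distrib[of cnj]
      cong: if_cong\<close>)
  \<comment> \<open>Nothing has been exchanged yet: all coordinates remain and the factor is
    \<open>t = 1\<close>.\<close>
  then show ?case
    by (intro disjI2 exI[of _ "[0..<n]"] exI[of _ "1::real"])
       (simp add: prod_om_eq_sp atLeast0LessThan)
next
  case (Suc m)
  define \<beta> where "\<beta> = sp n g m"
  define x where "x = hol n (g m)"
  define y where "y = ahol n (g m)"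
  define \<omega> where "\<omega> = omega n (g m)"
  have \<omega>: "\<omega> = \<i> *\<^sub>C (x * y)" by (simp add: \<omega>_def omega_def x_def y_def)
  have xy1: "x \<in> one_forms" "y \<in> one_forms" by (simp_all add: x_def y_def)
  have com: "commutes \<beta>" by (simp add: \<beta>_def)
  have sp: "sp n g (Suc m) = \<beta> * \<omega>" by (simp add: \<beta>_def \<omega>_def)
  show ?case
  proof (cases "\<beta> * \<omega> = 0")
    case False
    then have "\<beta> \<noteq> 0" by auto
    then obtain L t where L: "length L = n - m" "distinct L" "set L \<subseteq> {..<n}" "(t::real) \<ge> 0"
      and vol: "\<beta> * prod_list (map om L) = complex_of_real t *\<^sub>C sp n delta n"
      and ex: "\<forall>i<n. \<exists>b. dz i * \<beta> = (\<Sum>s\<in>set L. b s *\<^sub>C dz s) * \<beta> \<and>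
               dzb i * \<beta> = (\<Sum>s\<in>set L. cnj (b s) *\<^sub>C dzb s) * \<beta>"
      using Suc unfolding \<beta>_def by auto
    from ex obtain b where b: "\<And>i. i < n \<Longrightarrow> dz i * \<beta> = (\<Sum>s\<in>set L. b i s *\<^sub>C dz s) * \<beta>"
        "\<And>i. i < n \<Longrightarrow> dzb i * \<beta> = (\<Sum>s\<in>set L. cnj (b i s) *\<^sub>C dzb s) * \<beta>"
      by metis
    \<comment> \<open>The coefficients of the new covector once it is reduced to the coordinates in
      \<open>L\<close> modulo the annihilator of \<open>\<beta>\<close>.\<close>
    define c where "c s = (\<Sum>i<n. g m i * b i s)" for s
    have x\<beta>: "x * \<beta> = (\<Sum>s\<in>set L. c s *\<^sub>C dz s) * \<beta>"
    proof -
      have "x * \<beta> = (\<Sum>i<n. \<Sum>s\<in>set L. (g m i * b i s) *\<^sub>C (dz s * \<beta>))"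
        by (simp add: x_def hol_def sum_distrib_right b ext.scale_sum_right)
      also have "\<dots> = (\<Sum>s\<in>set L. c s *\<^sub>C dz s) * \<beta>"
        by (subst sum.swap) (simp add: c_def sum_distrib_right ext.scale_sum_left)
      finally show ?thesis .
    qed
    have y\<beta>: "y * \<beta> = (\<Sum>s\<in>set L. cnj (c s) *\<^sub>C dzb s) * \<beta>"
    proof -
      have "y * \<beta> = (\<Sum>i<n. \<Sum>s\<in>set L. cnj (g m i * b i s) *\<^sub>C (dzb s * \<beta>))"
        by (simp add: y_def ahol_def sum_distrib_right b ext.scale_sum_right)
      also have "\<dots> = (\<Sum>s\<in>set L. cnj (c s) *\<^sub>C dzb s) * \<beta>"
        by (subst sum.swap) (simp add: c_def sum_distrib_right ext.scale_sum_left)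
      finally show ?thesis .
    qed
    have \<beta>\<omega>: "\<beta> * \<omega> = \<i> *\<^sub>C (x * \<beta> * y)"
      using commutesD[OF com xy1(1)] by (simp add: \<omega> mult.assoc[symmetric])
    have x0: "x * (\<beta> * \<omega>) = 0"
      using commutesD[OF com xy1(1)] one_form_square[OF xy1(1)]
      by (simp add: \<omega> mult.assoc[symmetric])
    have y0: "y * (\<beta> * \<omega>) = 0"
    proof -
      have "y * (x * y) = 0"
        using one_form_anticommute[OF xy1(2,1)] one_form_square[OF xy1(2)]
        by (simp add: mult.assoc[symmetric]) (simp add: mult.assoc)
      moreover have "y * (\<beta> * (x * y)) = \<beta> * (y * (x * y))"
        using commutesD[OF com xy1(2)] by (metis mult.assoc)
      ultimately show ?thesis by (simp add: \<omega>)
    qed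
    \<comment> \<open>A pivot must exist, for otherwise \<open>x * \<beta>\<close>, and with it
      \<open>\<beta> * \<omega>\<close>, would vanish.\<close>
    have "\<exists>s\<in>set L. c s \<noteq> 0"
    proof (rule ccontr)
      assume "\<not> ?thesis"
      then have "x * \<beta> = 0" by (simp add: x\<beta>)
      then show False using False \<beta>\<omega> by simp
    qed
    then obtain s0 where s0: "s0 \<in> set L" "c s0 \<noteq> 0" by blast
    then obtain L1 L2 where split: "L = L1 @ s0 # L2" by (meson split_list)
    define L' where "L' = L1 @ L2"
    have L': "distinct L'" "s0 \<notin> set L'" "set L = insert s0 (set L')" "length L = Suc (length L')"
      using L(2) by (auto simp: split L'_def)
    define P where "P = prod_list (map om L')"
    have comP: "commutes P" by (simp add: P_def)
    have PL: "prod_list (map om L) = om s0 * P"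
      using commutes_swap_om[OF commutes_prod_om, of L1 s0]
      by (simp add: split P_def L'_def mult.assoc[symmetric])
    \<comment> \<open>Every \<open>dz s\<close> with \<open>s\<close> in \<open>L'\<close> is
      annihilated by \<open>P\<close>, so only the pivot term of \<open>x\<close> survives.\<close>
    have killx: "x * \<beta> * P = c s0 *\<^sub>C (dz s0 * \<beta> * P)"
    proof -
      have "dz s * \<beta> * P = 0" if "s \<in> set L'" for s
        using dz_prod_om[OF that] commutesD[OF com, of "dz s"]
        by (metis P_def mult.assoc mult_zero_right one_formsI(1))
      then show ?thesis
        using L' by (simp add: x\<beta> distrib_right sum_distrib_right)
    qed
    have killy: "y * \<beta> * P = cnj (c s0) *\<^sub>C (dzb s0 * \<beta> * P)"
    proof -
      have "dzb s * \<beta> * P = 0" if "s \<in> set L'" for s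
        using dzb_prod_om[OF that] commutesD[OF com, of "dzb s"]
        by (metis P_def mult.assoc mult_zero_right one_formsI(2))
      then show ?thesis
        using L' by (simp add: y\<beta> distrib_right sum_distrib_right)
    qed
    \<comment> \<open>Both one-forms of \<open>\<omega>\<close> are reduced to their pivot terms.
      The coefficients multiply to the squared modulus, and the generators supply the factor
      \<open>om s0\<close> that \<open>P\<close> lacks.\<close>
    have "\<beta> * \<omega> * P = \<i> *\<^sub>C (x * (y * \<beta> * P))"
      using commutes_swap[OF com xy1] by (simp add: \<omega>) (simp add: mult.assoc)
    also have "\<dots> = (\<i> * cnj (c s0)) *\<^sub>C (x * dzb s0 * (\<beta> * P))"
      unfolding killy by (simp add: mult.assoc)
    also have "x * dzb s0 = - (dzb s0 * x)"
      by (rule one_form_anticommute) (simp_all add: xy1)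
    also have "- (dzb s0 * x) * (\<beta> * P) = - (dzb s0 * (x * \<beta> * P))" by (simp add: mult.assoc)
    also have "\<dots> = c s0 *\<^sub>C (dz s0 * dzb s0 * (\<beta> * P))"
      unfolding killx using dz_dzb_anticommute[of s0 s0]
      by (simp add: mult.assoc[symmetric])
    also have "(\<i> * cnj (c s0)) *\<^sub>C c s0 *\<^sub>C (dz s0 * dzb s0 * (\<beta> * P)) =
       (c s0 * cnj (c s0)) *\<^sub>C (om s0 * \<beta> * P)"
      by (simp add: om_def mult_ac)
    also have "om s0 * \<beta> * P = \<beta> * prod_list (map om L)"
      using commutes_swap_om[OF com, of s0] by (simp add: PL mult.assoc[symmetric])
    also have "(c s0 * cnj (c s0)) *\<^sub>C (\<beta> * prod_list (map om L)) =
        complex_of_real ((cmod (c s0))\<^sup>2 * t) *\<^sub>C sp n delta n"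
      by (simp add: vol complex_norm_square[symmetric] del: of_real_power)
    finally have vol': "\<beta> * \<omega> * P = complex_of_real ((cmod (c s0))\<^sup>2 * t) *\<^sub>C sp n delta n" .
    have ex': "\<exists>b'. dz i * (\<beta> * \<omega>) = (\<Sum>s\<in>set L'. b' s *\<^sub>C dz s) * (\<beta> * \<omega>) \<and>
               dzb i * (\<beta> * \<omega>) = (\<Sum>s\<in>set L'. cnj (b' s) *\<^sub>C dzb s) * (\<beta> * \<omega>)" if "i < n" for i
    proof -
      \<comment> \<open>One elimination step: since \<open>x\<close> kills
        \<open>\<beta> * \<omega>\<close>, a multiple of it may be subtracted, chosen so that
        \<open>b' s0 = 0\<close> and \<open>dz s0\<close> drops out.\<close>
      define b' where "b' s = b i s - b i s0 / c s0 * c s" for s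
      have "dz i * (\<beta> * \<omega>) = dz i * (\<beta> * \<omega>) - (b i s0 / c s0) *\<^sub>C (x * (\<beta> * \<omega>))"
        by (simp add: x0)
      also have "\<dots> = (dz i * \<beta> - (b i s0 / c s0) *\<^sub>C (x * \<beta>)) * \<omega>"
        by (simp add: left_diff_distrib mult.assoc)
      also have "dz i * \<beta> - (b i s0 / c s0) *\<^sub>C (x * \<beta>) = (\<Sum>s\<in>set L. b' s *\<^sub>C dz s) * \<beta>"
        by (simp add: b[OF that] x\<beta> b'_def ext.scale_left_diff_distrib sum_subtractf ext.scale_sum_right
            left_diff_distrib sum_distrib_right)
      also have "(\<Sum>s\<in>set L. b' s *\<^sub>C dz s) = (\<Sum>s\<in>set L'. b' s *\<^sub>C dz s)"
        using L' s0 by (simp add: b'_def)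
      finally have 1: "dz i * (\<beta> * \<omega>) = (\<Sum>s\<in>set L'. b' s *\<^sub>C dz s) * (\<beta> * \<omega>)"
        by (simp add: mult.assoc)
      have "dzb i * (\<beta> * \<omega>) = dzb i * (\<beta> * \<omega>) - cnj (b i s0 / c s0) *\<^sub>C (y * (\<beta> * \<omega>))"
        by (simp add: y0)
      also have "\<dots> = (dzb i * \<beta> - cnj (b i s0 / c s0) *\<^sub>C (y * \<beta>)) * \<omega>"
        by (simp add: left_diff_distrib mult.assoc)
      also have "dzb i * \<beta> - cnj (b i s0 / c s0) *\<^sub>C (y * \<beta>) = (\<Sum>s\<in>set L. cnj (b' s) *\<^sub>C dzb s) * \<beta>"
        by (simp add: b[OF that] y\<beta> b'_def ext.scale_left_diff_distrib sum_subtractf ext.scale_sum_right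
            left_diff_distrib sum_distrib_right)
      also have "(\<Sum>s\<in>set L. cnj (b' s) *\<^sub>C dzb s) = (\<Sum>s\<in>set L'. cnj (b' s) *\<^sub>C dzb s)"
        using L' s0 by (simp add: b'_def)
      finally have 2: "dzb i * (\<beta> * \<omega>) = (\<Sum>s\<in>set L'. cnj (b' s) *\<^sub>C dzb s) * (\<beta> * \<omega>)"
        by (simp add: mult.assoc)
      from 1 2 show ?thesis by blast
    qed
    show ?thesis unfolding sp
      using L L' vol' ex' P_def
      by (intro disjI2 exI[of _ L'] exI[of _ "(cmod (c s0))\<^sup>2 * t"]) auto
  next
    case True
    then show ?thesis unfolding sp by blast
  qed
qed

section \<open>Bivectors in four covectors\<close>

datatype six = P1 | M1 | P2 | M2 | P3 | M3

lemma UNIV_six: "(UNIV :: six set) = {P1, M1, P2, M2, P3, M3}"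
  by (auto intro: six.exhaust)

instance six :: finite
  by standard (simp add: UNIV_six)

lemma card_six: "CARD(six) = 6"
  by (simp add: UNIV_six)

text \<open>
  For \<open>w\<^sup>2 = -1\<close> the wedge pairing on bivectors in \<open>a, b, c, d\<close> is diagonal in this basis. The conjugate
  basis is obtained with \<open>-w\<close>.
\<close>

fun klein_basis :: "complex \<Rightarrow> ext \<Rightarrow> ext \<Rightarrow> ext \<Rightarrow> ext \<Rightarrow> six \<Rightarrow> ext" where
  "klein_basis w a b c d P1 = a * b + c * d"
| "klein_basis w a b c d M1 = w *\<^sub>C (a * b - c * d)"
| "klein_basis w a b c d P2 = a * c + d * b"
| "klein_basis w a b c d M2 = w *\<^sub>C (a * c - d * b)"
| "klein_basis w a b c d P3 = a * d + b * c"
| "klein_basis w a b c d M3 = w *\<^sub>C (a * d - b * c)"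

lemma commutes_klein_basis [simp]:
  "a \<in> one_forms \<Longrightarrow> b \<in> one_forms \<Longrightarrow> c \<in> one_forms \<Longrightarrow> d \<in> one_forms \<Longrightarrow>
    commutes (klein_basis w a b c d P)"
  by (cases P) simp_all

lemma one_form_anticommute_left:
  "x \<in> one_forms \<Longrightarrow> y \<in> one_forms \<Longrightarrow> x * (y * z) = - (y * (x * z))"
  by (metis mult.assoc mult_minus_left one_form_anticommute)

lemma one_form_square_left: "x \<in> one_forms \<Longrightarrow> x * (x * z) = 0"
  by (metis mult.assoc mult_zero_left one_form_square)

lemma cscale_2: "2 *\<^sub>C x = x + x"
  by (metis ext.scale_left_distrib ext.scale_one one_add_one)

text \<open>The pairs \<open>a * b\<close> and \<open>c * d\<close>, \<open>a * c\<close> and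
  \<open>d * b\<close>, \<open>a * d\<close> and \<open>b * c\<close> are complementary, each with
  product \<open>a * b * c * d\<close>. The sum of a pair squares to twice this and the difference
  to minus twice this, a sign that \<open>w * w = -1\<close> corrects.\<close>

lemma klein_basis_mult:
  assumes w: "w * w = -1" and "a \<in> one_forms" "b \<in> one_forms" "c \<in> one_forms" "d \<in> one_forms"
  shows "klein_basis w a b c d P * klein_basis w a b c d Q =
    (if P = Q then 2 *\<^sub>C (a * b * c * d) else 0)"
proof -
  note anti = one_form_anticommute[OF assms(3,2)] one_form_anticommute[OF assms(4,2)]
    one_form_anticommute[OF assms(5,2)] one_form_anticommute[OF assms(4,3)]
    one_form_anticommute[OF assms(5,3)] one_form_anticommute[OF assms(5,4)]
    one_form_anticommute_left[OF assms(3,2)] one_form_anticommute_left[OF assms(4,2)]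
    one_form_anticommute_left[OF assms(5,2)] one_form_anticommute_left[OF assms(4,3)]
    one_form_anticommute_left[OF assms(5,3)] one_form_anticommute_left[OF assms(5,4)]
  note sq = assms(2-5)[THEN one_form_square] assms(2-5)[THEN one_form_square_left]
  show ?thesis
    by (cases P; cases Q)
       (simp_all add: w cscale_2 distrib_left distrib_right left_diff_distrib right_diff_distrib mult.assoc anti sq
         ext.scale_right_distrib ext.scale_right_diff_distrib)
qed

text \<open>The fourth Pluecker coordinate is indexed by 42 rather than 24, so that all signs in the Pluecker
  relation are positive.\<close>

fun klein_coord :: "complex \<Rightarrow> complex \<Rightarrow> complex \<Rightarrow> complex \<Rightarrow> complex \<Rightarrow> complex \<Rightarrow> complex \<Rightarrow> six \<Rightarrow> complex" where
  "klein_coord w p12 p34 p13 p42 p14 p23 P1 = (p12 + p34) / 2"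
| "klein_coord w p12 p34 p13 p42 p14 p23 M1 = (p12 - p34) / (2 * w)"
| "klein_coord w p12 p34 p13 p42 p14 p23 P2 = (p13 + p42) / 2"
| "klein_coord w p12 p34 p13 p42 p14 p23 M2 = (p13 - p42) / (2 * w)"
| "klein_coord w p12 p34 p13 p42 p14 p23 P3 = (p14 + p23) / 2"
| "klein_coord w p12 p34 p13 p42 p14 p23 M3 = (p14 - p23) / (2 * w)"

lemma sum_klein_coord:
  assumes "w \<noteq> 0"
  shows "(\<Sum>P\<in>UNIV. klein_coord w p12 p34 p13 p42 p14 p23 P *\<^sub>C klein_basis w a b c d P)
    = p12 *\<^sub>C (a * b) + p34 *\<^sub>C (c * d) + p13 *\<^sub>C (a * c) + p42 *\<^sub>C (d * b) + p14 *\<^sub>C (a * d) + p23 *\<^sub>C (b * c)"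
proof -
  have half: "((p + q) / 2) *\<^sub>C (x + y) + ((p - q) / 2) *\<^sub>C (x - y) = p *\<^sub>C x + q *\<^sub>C y" for p q x y
    by transfer (simp add: fun_eq_iff scale_form_def field_simps)
  have "(\<Sum>P\<in>UNIV. klein_coord w p12 p34 p13 p42 p14 p23 P *\<^sub>C klein_basis w a b c d P) =
     (((p12 + p34) / 2) *\<^sub>C (a * b + c * d) + ((p12 - p34) / 2) *\<^sub>C (a * b - c * d)) +
     (((p13 + p42) / 2) *\<^sub>C (a * c + d * b) + ((p13 - p42) / 2) *\<^sub>C (a * c - d * b)) +
     (((p14 + p23) / 2) *\<^sub>C (a * d + b * c) + ((p14 - p23) / 2) *\<^sub>C (a * d - b * c))"
    using assms by (simp add: UNIV_six add.assoc)
  then show ?thesis unfolding half by (simp add: add.assoc)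
qed

text \<open>The coefficients are the six minors of the two coefficient rows, the one for
  \<open>d * b\<close> being taken in that order.\<close>

lemma one_form_mult_klein:
  assumes "w \<noteq> 0" and "a \<in> one_forms" "b \<in> one_forms" "c \<in> one_forms" "d \<in> one_forms"
  shows "(u1 *\<^sub>C a + u2 *\<^sub>C b + u3 *\<^sub>C c + u4 *\<^sub>C d) * (v1 *\<^sub>C a + v2 *\<^sub>C b + v3 *\<^sub>C c + v4 *\<^sub>C d) =
    (\<Sum>P\<in>UNIV. klein_coord w (u1 * v2 - u2 * v1) (u3 * v4 - u4 * v3) (u1 * v3 - u3 * v1) (u4 * v2 - u2 * v4)
      (u1 * v4 - u4 * v1) (u2 * v3 - u3 * v2) P *\<^sub>C klein_basis w a b c d P)"
proof -
  note anti = one_form_anticommute[OF assms(3,2)] one_form_anticommute[OF assms(4,2)]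
    one_form_anticommute[OF assms(5,2)] one_form_anticommute[OF assms(4,3)]
    one_form_anticommute[OF assms(5,3)] one_form_anticommute[OF assms(5,4)]
  note sq = assms(2-5)[THEN one_form_square]
  show ?thesis unfolding sum_klein_coord[OF assms(1)]
    by (simp add: distrib_left distrib_right anti sq ext.scale_left_diff_distrib
        ext.scale_right_distrib ext.scale_right_diff_distrib mult.commute)
qed

text \<open>For \<open>w = \<i>\<close> conjugation passes to \<open>- \<i>\<close>, so conjugate
  coordinates refer to the conjugate basis.\<close>

lemma klein_coord_cnj:
  "cnj (klein_coord w p12 p34 p13 p42 p14 p23 P) =
    klein_coord (cnj w) (cnj p12) (cnj p34) (cnj p13) (cnj p42) (cnj p14) (cnj p23) P"
  by (cases P) simp_all

section \<open>Isotropic coordinates and decomposable bivectors\<close>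

text \<open>The coordinates fill a skew 4 x 4 matrix. If its entry at \<open>(i, j)\<close> is
  nonzero, the witnesses are column \<open>j\<close> and row \<open>i\<close> divided by that entry.
  Five minors then come out directly, and the relation supplies the complementary one.\<close>

lemma plucker_decomposable:
  fixes p12 :: complex
  assumes "p12 * p34 + p13 * p42 + p14 * p23 = 0"
  shows "\<exists>u1 u2 u3 u4 v1 v2 v3 v4. u1 * v2 - u2 * v1 = p12 \<and> u3 * v4 - u4 * v3 = p34 \<and>
    u1 * v3 - u3 * v1 = p13 \<and> u4 * v2 - u2 * v4 = p42 \<and> u1 * v4 - u4 * v1 = p14 \<and> u2 * v3 - u3 * v2 = p23"
proof -
  consider "p12 \<noteq> 0" | "p13 \<noteq> 0" | "p14 \<noteq> 0" | "p23 \<noteq> 0" | "p42 \<noteq> 0" | "p34 \<noteq> 0"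
    | "p12 = 0" "p13 = 0" "p14 = 0" "p23 = 0" "p42 = 0" "p34 = 0" by blast
  then show ?thesis
  proof cases
    case 1
    have eq: "p34 = - (p13 * p42 + p14 * p23) / p12"
      using assms 1 by (simp add: field_simps eq_neg_iff_add_eq_0)
    show ?thesis unfolding eq
      by (rule exI[of _ "p12"], rule exI[of _ "0"], rule exI[of _ "-p23"], rule exI[of _ "p42"], rule exI[of _ "0"], rule exI[of _ "1"], rule exI[of _ "p13 / p12"], rule exI[of _ "p14 / p12"])
        (use 1 in \<open>simp add: field_simps\<close>)
  next
    case 2
    have eq: "p42 = - (p12 * p34 + p14 * p23) / p13"
      using assms 2 by (simp add: field_simps eq_neg_iff_add_eq_0)
    show ?thesis unfolding eq
      by (rule exI[of _ "p13"], rule exI[of _ "p23"], rule exI[of _ "0"], rule exI[of _ "-p34"], rule exI[of _ "0"], rule exI[of _ "p12 / p13"], rule exI[of _ "1"], rule exI[of _ "p14 / p13"])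
        (use 2 in \<open>simp add: field_simps\<close>)
  next
    case 3
    have eq: "p23 = - (p12 * p34 + p13 * p42) / p14"
      using assms 3 by (simp add: field_simps eq_neg_iff_add_eq_0)
    show ?thesis unfolding eq
      by (rule exI[of _ "p14"], rule exI[of _ "-p42"], rule exI[of _ "p34"], rule exI[of _ "0"], rule exI[of _ "0"], rule exI[of _ "p12 / p14"], rule exI[of _ "p13 / p14"], rule exI[of _ "1"])
        (use 3 in \<open>simp add: field_simps\<close>)
  next
    case 4
    have eq: "p14 = - (p12 * p34 + p13 * p42) / p23"
      using assms 4 by (simp add: field_simps eq_neg_iff_add_eq_0)
    show ?thesis unfolding eq
      by (rule exI[of _ "p13"], rule exI[of _ "p23"], rule exI[of _ "0"], rule exI[of _ "-p34"], rule exI[of _ "-p12 / p23"], rule exI[of _ "0"], rule exI[of _ "1"], rule exI[of _ "-p42 / p23"])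
        (use 4 in \<open>simp add: field_simps\<close>)
  next
    case 5
    have eq: "p13 = - (p12 * p34 + p14 * p23) / p42"
      using assms 5 by (simp add: field_simps eq_neg_iff_add_eq_0)
    show ?thesis unfolding eq
      by (rule exI[of _ "p14"], rule exI[of _ "-p42"], rule exI[of _ "p34"], rule exI[of _ "0"], rule exI[of _ "p12 / p42"], rule exI[of _ "0"], rule exI[of _ "-p23 / p42"], rule exI[of _ "1"])
        (use 5 in \<open>simp add: field_simps\<close>)
  next
    case 6
    have eq: "p12 = - (p13 * p42 + p14 * p23) / p34"
      using assms 6 by (simp add: field_simps eq_neg_iff_add_eq_0)
    show ?thesis unfolding eq
      by (rule exI[of _ "p14"], rule exI[of _ "-p42"], rule exI[of _ "p34"], rule exI[of _ "0"], rule exI[of _ "-p13 / p34"], rule exI[of _ "-p23 / p34"], rule exI[of _ "0"], rule exI[of _ "1"])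
        (use 6 in \<open>simp add: field_simps\<close>)
  next
    case 7
    then show ?thesis by (intro exI[of _ 0]) simp
  qed
qed

text \<open>Factoring \<open>(z P1)\<^sup>2 + (z M1)\<^sup>2\<close> over the complex numbers, and
  likewise the two other pairs, turns isotropy into the Pluecker relation.\<close>

lemma isotropic_decomposable:
  assumes "(\<Sum>P\<in>UNIV. (z P)\<^sup>2) = 0"
  shows "\<exists>u1 u2 u3 u4 v1 v2 v3 v4. z = klein_coord \<i> (u1 * v2 - u2 * v1) (u3 * v4 - u4 * v3)
    (u1 * v3 - u3 * v1) (u4 * v2 - u2 * v4) (u1 * v4 - u4 * v1) (u2 * v3 - u3 * v2)"
proof -
  have "z = klein_coord \<i> (z P1 + \<i> * z M1) (z P1 - \<i> * z M1) (z P2 + \<i> * z M2) (z P2 - \<i> * z M2)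
      (z P3 + \<i> * z M3) (z P3 - \<i> * z M3)"
  proof
    fix P show "z P = klein_coord \<i> (z P1 + \<i> * z M1) (z P1 - \<i> * z M1) (z P2 + \<i> * z M2) (z P2 - \<i> * z M2)
      (z P3 + \<i> * z M3) (z P3 - \<i> * z M3) P" by (cases P) simp_all
  qed
  moreover have "(z P1 + \<i> * z M1) * (z P1 - \<i> * z M1) + (z P2 + \<i> * z M2) * (z P2 - \<i> * z M2)
      + (z P3 + \<i> * z M3) * (z P3 - \<i> * z M3) = 0"
    using assms by (simp add: UNIV_six power2_eq_square algebra_simps)
  ultimately show ?thesis using plucker_decomposable by metis
qed

section \<open>Expansion of forms and products of matrix forms\<close>

lemma is_form_to_ext:
  assumes "is_form n p q \<alpha>"
  shows "form_of (to_ext \<alpha>) = \<alpha>"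
proof (rule to_ext_inverse)
  show "\<alpha> \<in> {a. \<forall>I J. \<not> (finite I \<and> finite J) \<longrightarrow> a (I, J) = 0}"
    using assms unfolding is_form_def by clarify (meson finite_lessThan finite_subset)
qed

lemma ext_eq_sum_monomials:
  assumes "is_form n p q (form_of x)"
  shows "x = (\<Sum>(I, J)\<in>Pow {..<n} \<times> Pow {..<n}. form_of x (I, J) *\<^sub>C monomial I J)"
proof (intro form_of_inject[THEN iffD1] HOL.ext, clarify)
  fix K M
  have "form_of (\<Sum>(I, J)\<in>Pow {..<n} \<times> Pow {..<n}. form_of x (I, J) *\<^sub>C monomial I J) (K, M)
    = (\<Sum>IJ\<in>Pow {..<n} \<times> Pow {..<n}. if IJ = (K, M) then form_of x (K, M) else 0)"
    unfolding form_of_sum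
  proof (intro sum.cong refl, clarify)
    fix I J assume "I \<subseteq> {..<n}" "J \<subseteq> {..<n}"
    then have "finite I" "finite J" using finite_subset by blast+
    then show "form_of (form_of x (I, J) *\<^sub>C monomial I J) (K, M) =
        (if (I, J) = (K, M) then form_of x (K, M) else 0)"
      by (auto simp: cscale.rep_eq scale_form_def form_of_monomial)
  qed
  also have "\<dots> = form_of x (K, M)"
    using assms unfolding is_form_def by (cases "form_of x (K, M) = 0") auto
  finally show "form_of x (K, M) = form_of (\<Sum>(I, J)\<in>Pow {..<n} \<times> Pow {..<n}. form_of x (I, J) *\<^sub>C monomial I J) (K, M)"
    by simp
qed

lemma monomial_2_2:
  "i < j \<Longrightarrow> k < l \<Longrightarrow> monomial {i, j} {k, l} = (dz i * dz j) * (dzb k * dzb l)"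
  by (simp add: dz_def dzb_def monomial_mult shuffle_sign_singletons insert_commute)

lemma card_2_nat_less:
  assumes "card (I :: nat set) = 2"
  obtains i j where "i < j" "I = {i, j}"
  using assms unfolding card_2_iff by (metis insert_commute linorder_neqE_nat)

lemma is_form_wedge:
  assumes a: "is_form n p q a" and b: "is_form n r s b"
  shows "is_form n (p + r) (q + s) (wedge a b)"
  unfolding is_form_def
proof (intro allI impI)
  fix I J assume nz: "wedge a b (I, J) \<noteq> 0"
  then obtain I1 J1 where 1: "I1 \<subseteq> I" "J1 \<subseteq> J" "a (I1, J1) \<noteq> 0" "b (I - I1, J - J1) \<noteq> 0"
    unfolding wedge_apply by (auto elim!: sum.not_neutral_contains_not_neutral)
  have fin: "finite I" "finite J" using nz wedge_infinite by blast+
  have A: "I1 \<subseteq> {..<n}" "J1 \<subseteq> {..<n}" "card I1 = p" "card J1 = q"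
    using a 1(3) by (auto simp: is_form_def)
  have B: "I - I1 \<subseteq> {..<n}" "J - J1 \<subseteq> {..<n}" "card (I - I1) = r" "card (J - J1) = s"
    using b 1(4) by (auto simp: is_form_def)
  show "I \<subseteq> {..<n} \<and> J \<subseteq> {..<n} \<and> card I = p + r \<and> card J = q + s"
    using A B 1(1,2) fin card_mono[of I I1] card_mono[of J J1]
    by (auto simp: card_Diff_subset finite_subset)
qed

lemma nonneg_top_form_of:
  "nonneg_top n (form_of x) \<longleftrightarrow> (\<exists>c::real. c \<ge> 0 \<and> x = complex_of_real c *\<^sub>C sp n delta n)"
proof -
  have "vol n = form_of (sp n delta n)"
    unfolding form_of_sp vol_def delta_def ..
  then show ?thesis
    by (simp add: nonneg_top_def form_of_inject[symmetric] cscale.rep_eq)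
qed

text \<open>The \<open>Y R\<close> move past the \<open>X P\<close>, and orthogonality in each frame
  leaves only the diagonal terms. So matrix forms multiply by the entrywise bilinear pairing, with a
  factor 2 from each frame.\<close>

lemma klein_frame_product:
  fixes X Y :: "six \<Rightarrow> ext"
  assumes X: "\<And>P Q. X P * X Q = (if P = Q then 2 *\<^sub>C D else 0)"
    and Y: "\<And>P Q. Y P * Y Q = (if P = Q then 2 *\<^sub>C E else 0)"
    and XY: "\<And>P Q. Y P * X Q = X Q * Y P"
  shows "(\<Sum>P\<in>UNIV. \<Sum>R\<in>UNIV. A P R *\<^sub>C (X P * Y R)) * (\<Sum>P\<in>UNIV. \<Sum>R\<in>UNIV. B P R *\<^sub>C (X P * Y R))
    = (4 * (\<Sum>P\<in>UNIV. \<Sum>R\<in>UNIV. A P R * B P R)) *\<^sub>C (D * E)"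
proof -
  let ?F = "\<lambda>C p. C (fst p) (snd p) *\<^sub>C (X (fst p) * Y (snd p))"
  have pair: "(\<Sum>P\<in>UNIV. \<Sum>R\<in>UNIV. C P R *\<^sub>C (X P * Y R)) = (\<Sum>p\<in>UNIV. ?F C p)" for C
    by (simp add: sum.cartesian_product case_prod_unfold)
  have XYXY: "X (fst p) * Y (snd p) * (X (fst q) * Y (snd q)) = (if q = p then 4 *\<^sub>C (D * E) else 0)" for p q
  proof -
    have "X (fst p) * Y (snd p) * (X (fst q) * Y (snd q)) = X (fst p) * X (fst q) * (Y (snd p) * Y (snd q))"
      using XY by (metis mult.assoc)
    then show ?thesis by (auto simp: X Y prod_eq_iff)
  qed
  have "(\<Sum>p\<in>UNIV. ?F A p) * (\<Sum>p\<in>UNIV. ?F B p) =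
      (\<Sum>p\<in>UNIV. \<Sum>q\<in>UNIV. if q = p then (A (fst p) (snd p) * B (fst p) (snd p) * 4) *\<^sub>C (D * E) else 0)"
    unfolding sum_product by (intro sum.cong refl) (simp add: XYXY)
  also have "\<dots> = (\<Sum>p\<in>UNIV. (4 * (A (fst p) (snd p) * B (fst p) (snd p))) *\<^sub>C (D * E))"
    by (simp add: mult_ac)
  also have "\<dots> = (4 * (\<Sum>P\<in>UNIV. \<Sum>R\<in>UNIV. A P R * B P R)) *\<^sub>C (D * E)"
    by (simp add: sum.cartesian_product case_prod_unfold sum_distrib_left ext.scale_sum_left)
  finally show ?thesis unfolding pair .
qed

lemma commutes_swap_prod_om:
  "commutes z \<Longrightarrow> z * prod_list (map om L) = prod_list (map om L) * z"
proof (induction L)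
  case (Cons s L)
  then show ?case using commutes_swap_om[of z s] by simp (metis mult.assoc)
qed simp

text \<open>Factors are replaced one at a time modulo the annihilator of \<open>\<beta>\<close>:
  first \<open>v\<close>, then \<open>\<beta>\<close> moves left past \<open>v'\<close> to reach
  \<open>u\<close>.\<close>

lemma mult_cong_right_factor:
  fixes \<beta> :: "'a::semigroup_mult"
  assumes "u * \<beta> = u' * \<beta>" "v * \<beta> = v' * \<beta>" "\<beta> * v' = v' * \<beta>"
  shows "u * v * \<beta> = u' * v' * \<beta>"
  by (metis assms mult.assoc)

text \<open>Regrouping costs one transposition of one-forms, whose sign cancels against
  \<open>\<i> * \<i>\<close>.\<close>

lemma omega_mult_omega:
  "omega n u * omega n v = (hol n u * hol n v) * (ahol n u * ahol n v)"
proof -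
  have "hol n u * ahol n u * (hol n v * ahol n v) = - (hol n u * hol n v * (ahol n u * ahol n v))"
    using one_form_anticommute_left[of "ahol n u" "hol n v" "ahol n v"] by (simp add: mult.assoc)
  then show ?thesis by (simp add: omega_def)
qed

section \<open>Reduction to a 6 x 6 matrix, and positivity of the square\<close>

theorem theorem1:
  fixes n :: nat and \<alpha> :: form
  assumes "n \<ge> 1"
    and "positive_form n 2 \<alpha>"
  shows "positive_form n 4 (wedge \<alpha> \<alpha>)"
proof (cases "n < 4")
  case True
  have "is_form n 2 2 \<alpha>" using assms(2) by (simp add: positive_form_def)
  from is_form_wedge[OF this this] True show ?thesis by (simp add: positive_form_def)
next
  case False
  then have n4: "n \<ge> 4" by simp
  have form\<alpha>: "is_form n 2 2 \<alpha>" using assms(2) by (simp add: positive_form_def)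
  define a where "a = to_ext \<alpha>"
  have a: "form_of a = \<alpha>" unfolding a_def by (rule is_form_to_ext[OF form\<alpha>])
  have pos: "\<exists>c::real. c \<ge> 0 \<and> a * sp n g (n - 2) = complex_of_real c *\<^sub>C sp n delta n" for g
  proof -
    have "nonneg_top n (form_of (a * sp n g (n - 2)))"
      using assms(2) n4 by (simp add: positive_form_def times_ext.rep_eq a form_of_sp)
    then show ?thesis unfolding nonneg_top_form_of .
  qed
  have "\<exists>c::real. c \<ge> 0 \<and> a * a * sp n g (n - 4) = complex_of_real c *\<^sub>C sp n delta n" for g
  proof -
    define m where "m = n - 4"
    have m: "n = m + 4" using n4 by (simp add: m_def)
    define \<beta> where "\<beta> = sp n g m"
    have com: "commutes \<beta>" by (simp add: \<beta>_def)
    show ?thesis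
    proof (cases "\<beta> = 0")
      case True
      then show ?thesis unfolding \<beta>_def m_def by (intro exI[of _ "0::real"]) simp
    next
      case False
      \<comment> \<open>Since \<open>n - m = 4\<close>, the exchange leaves exactly four
        coordinates.\<close>
      then obtain L t where L: "length L = 4" "distinct L" "set L \<subseteq> {..<n}" "(t::real) \<ge> 0"
        and vol: "\<beta> * prod_list (map om L) = complex_of_real t *\<^sub>C sp n delta n"
        and ex: "\<forall>i<n. \<exists>b. dz i * \<beta> = (\<Sum>s\<in>set L. b s *\<^sub>C dz s) * \<beta> \<and>
               dzb i * \<beta> = (\<Sum>s\<in>set L. cnj (b s) *\<^sub>C dzb s) * \<beta>"
        using sp_exchange[of m n g] unfolding \<beta>_def by (auto simp: m)
      obtain s1 s2 s3 s4 where L4: "L = [s1, s2, s3, s4]"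
        using L(1) by (auto simp: numeral_eq_Suc length_Suc_conv)
      have dist: "s1 \<noteq> s2" "s1 \<noteq> s3" "s1 \<noteq> s4" "s2 \<noteq> s3" "s2 \<noteq> s4" "s3 \<noteq> s4"
        using L(2) by (auto simp: L4)
      have sn: "s1 < n" "s2 < n" "s3 < n" "s4 < n" using L(3) by (auto simp: L4)
      define X where "X = klein_basis \<i> (dz s1) (dz s2) (dz s3) (dz s4)"
      define Y where "Y = klein_basis (- \<i>) (dzb s1) (dzb s2) (dzb s3) (dzb s4)"
      define D where "D = dz s1 * dz s2 * dz s3 * dz s4"
      define E where "E = dzb s1 * dzb s2 * dzb s3 * dzb s4"
      define \<tau> where "\<tau> = complex_of_real t *\<^sub>C sp n delta n"
      have XX: "X P * X Q = (if P = Q then 2 *\<^sub>C D else 0)" for P Q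
        unfolding X_def D_def by (rule klein_basis_mult) simp_all
      have YY: "Y P * Y Q = (if P = Q then 2 *\<^sub>C E else 0)" for P Q
        unfolding Y_def E_def by (rule klein_basis_mult) simp_all
      have comY: "commutes (Y P)" for P
        unfolding Y_def by simp
      have swapX: "z * X P = X P * z" and swapY: "z * Y P = Y P * z" if "commutes z" for z P
        using commutes_swap[OF that]
        by (cases P; simp add: X_def Y_def distrib_left distrib_right right_diff_distrib left_diff_distrib)+
      \<comment> \<open>Sorting the four \<open>om\<close> factors takes six transpositions, and the
        four scalars \<open>\<i>\<close> multiply to 1, so no sign appears.\<close>
      have \<beta>DE: "D * E * \<beta> = \<tau>"
      proof -
        have "prod_list (map om L) = D * E"
          using dz_dzb_anticommute one_form_anticommute_left[of "dzb _" "dz _"]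
          by (simp add: L4 om_def D_def E_def mult.assoc)
        then show ?thesis using vol commutes_swap_prod_om[OF com, of L] by (simp add: \<tau>_def)
      qed
      note frame = klein_frame_product[of X D Y E, OF XX YY swapX[OF comY]]
      define T where "T A = (\<Sum>P\<in>UNIV. \<Sum>R\<in>UNIV. A P R *\<^sub>C (X P * Y R))" for A :: "six \<Rightarrow> six \<Rightarrow> complex"
      define U where "U b = b s1 *\<^sub>C dz s1 + b s2 *\<^sub>C dz s2 + b s3 *\<^sub>C dz s3 + b s4 *\<^sub>C dz s4" for b
      define V where "V b = cnj (b s1) *\<^sub>C dzb s1 + cnj (b s2) *\<^sub>C dzb s2 + cnj (b s3) *\<^sub>C dzb s3
        + cnj (b s4) *\<^sub>C dzb s4" for b
      have UV1: "U b \<in> one_forms" "V b \<in> one_forms" for b by (simp_all add: U_def V_def)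
      have sumL: "(\<Sum>s\<in>set L. b s *\<^sub>C dz s) = U b" "(\<Sum>s\<in>set L. cnj (b s) *\<^sub>C dzb s) = V b" for b
        using dist by (simp_all add: L4 U_def V_def add.assoc)
      have UU: "\<exists>z. U b * U b' = (\<Sum>P\<in>UNIV. z P *\<^sub>C X P)" for b b'
        unfolding U_def X_def by (rule exI, rule one_form_mult_klein) simp_all
      have VV: "\<exists>z. V b * V b' = (\<Sum>P\<in>UNIV. z P *\<^sub>C Y P)" for b b'
        unfolding V_def Y_def by (rule exI, rule one_form_mult_klein) simp_all
      have XsYs: "(\<Sum>P\<in>UNIV. z P *\<^sub>C X P) * (\<Sum>R\<in>UNIV. w R *\<^sub>C Y R) = T (\<lambda>P R. z P * w R)" for z w
        by (simp add: T_def sum_product mult_ac)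
      have swapT: "\<beta> * T A = T A * \<beta>" for A
      proof -
        have "\<beta> * (X P * Y R) = X P * Y R * \<beta>" for P R
          using swapX[OF com, of P] swapY[OF com, of R] by (metis mult.assoc)
        then show ?thesis by (simp add: T_def sum_distrib_left sum_distrib_right)
      qed
      have T_add: "T A + T B = T (\<lambda>P R. A P R + B P R)" for A B
        by (simp add: T_def ext.scale_left_distrib sum.distrib)
      have T_scale: "c *\<^sub>C T A = T (\<lambda>P R. c * A P R)" for c A
        by (simp add: T_def ext.scale_sum_right)
      \<comment> \<open>Being a matrix form modulo the annihilator of \<open>\<beta>\<close>. This
        is closed under linear combinations, so only products of two \<open>dz\<close> and two
        \<open>dzb\<close> have to be examined.\<close>
      define repr where "repr x \<longleftrightarrow> (\<exists>A. x * \<beta> = T A * \<beta>)" for x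
      have repr_scale: "repr (c *\<^sub>C x)" if "repr x" for c x
      proof -
        from that obtain A where "x * \<beta> = T A * \<beta>" by (auto simp: repr_def)
        then have "(c *\<^sub>C x) * \<beta> = (c *\<^sub>C T A) * \<beta>" by simp
        then show ?thesis unfolding T_scale repr_def by blast
      qed
      have repr_0: "repr 0"
        unfolding repr_def by (rule exI[of _ "\<lambda>P R. 0"]) (simp add: T_def)
      have repr_add: "repr (x + y)" if "repr x" "repr y" for x y
        using that T_add unfolding repr_def by (metis distrib_right)
      have repr_sum: "repr (sum f S)" if "\<And>i. i \<in> S \<Longrightarrow> repr (f i)" for f and S :: "(nat set \<times> nat set) set"
        using that by (induction S rule: infinite_finite_induct) (simp_all add: repr_0 repr_add)
      have repr_gen: "repr ((dz i * dz j) * (dzb k * dzb l))" if "i < n" "j < n" "k < n" "l < n" for i j k l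
      proof -
        from ex[unfolded sumL] obtain b where
          b: "\<And>i. i < n \<Longrightarrow> dz i * \<beta> = U (b i) * \<beta>" "\<And>i. i < n \<Longrightarrow> dzb i * \<beta> = V (b i) * \<beta>"
          by metis
        obtain z where z: "U (b i) * U (b j) = (\<Sum>P\<in>UNIV. z P *\<^sub>C X P)" using UU by blast
        obtain w where w: "V (b k) * V (b l) = (\<Sum>P\<in>UNIV. w P *\<^sub>C Y P)" using VV by blast
        have "dz i * dz j * \<beta> = U (b i) * U (b j) * \<beta>"
          by (intro mult_cong_right_factor b that commutesD[OF com] UV1)
        moreover have "dzb k * dzb l * \<beta> = V (b k) * V (b l) * \<beta>"
          by (intro mult_cong_right_factor b that commutesD[OF com] UV1)
        ultimately have "(dz i * dz j) * (dzb k * dzb l) * \<beta> = (U (b i) * U (b j)) * (V (b k) * V (b l)) * \<beta>"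
          by (rule mult_cong_right_factor) (simp add: commutes_swap[OF com] UV1)
        then show ?thesis unfolding z w XsYs repr_def by blast
      qed
      have "repr a"
      proof -
        have "repr (form_of a (I, J) *\<^sub>C monomial I J)" for I J
        proof (cases "\<alpha> (I, J) = 0")
          case False
          then have IJ: "I \<subseteq> {..<n}" "J \<subseteq> {..<n}" "card I = 2" "card J = 2"
            using form\<alpha> by (auto simp: is_form_def)
          obtain i j where "i < j" "I = {i, j}" using IJ(3) by (rule card_2_nat_less)
          moreover obtain k l where "k < l" "J = {k, l}" using IJ(4) by (rule card_2_nat_less)
          ultimately show ?thesis using IJ(1,2)
            by (intro repr_scale) (simp add: monomial_2_2 repr_gen)
        qed (simp add: a repr_0)
        then have "repr (\<Sum>(I, J)\<in>Pow {..<n} \<times> Pow {..<n}. form_of a (I, J) *\<^sub>C monomial I J)"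
          by (intro repr_sum) auto
        moreover have "is_form n 2 2 (form_of a)" using form\<alpha> by (simp add: a)
        note ext_eq_sum_monomials[OF this, symmetric]
        ultimately show ?thesis by (simp only:)
      qed
      then obtain A where A: "a * \<beta> = T A * \<beta>" by (auto simp: repr_def)
      have TT: "T A * T B * \<beta> = (4 * (\<Sum>P\<in>UNIV. \<Sum>R\<in>UNIV. A P R * B P R)) *\<^sub>C \<tau>" for B
        unfolding T_def frame using \<beta>DE by simp
      have square: "a * a * \<beta> = (4 * (\<Sum>P\<in>UNIV. \<Sum>R\<in>UNIV. (A P R)\<^sup>2)) *\<^sub>C \<tau>"
        using mult_cong_right_factor[OF A A swapT] TT[of A] by (simp add: power2_eq_square)
      show ?thesis
      \<comment> \<open>If \<open>\<tau>\<close> vanishes, so does the square. Otherwise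
        coefficients of the volume form can be compared and \<open>t\<close> divided out.\<close>
      proof (cases "\<tau> = 0")
        case True
        then show ?thesis using square unfolding \<beta>_def m_def
          by (intro exI[of _ "0::real"]) simp
      next
        case False
        then have t: "t > 0" and vol0: "sp n delta n \<noteq> 0" using L(4) by (auto simp: \<tau>_def less_le)
        have "(\<Sum>P\<in>UNIV. \<Sum>R\<in>UNIV. A P R * z P * cnj (z R)) \<in> \<real>\<^sub>\<ge>\<^sub>0"
          if iso: "(\<Sum>P\<in>UNIV. (z P)\<^sup>2) = 0" for z
        proof -
          from isotropic_decomposable[OF iso] obtain u1 u2 u3 u4 v1 v2 v3 v4 where
            z: "z = klein_coord \<i> (u1 * v2 - u2 * v1) (u3 * v4 - u4 * v3)
              (u1 * v3 - u3 * v1) (u4 * v2 - u2 * v4) (u1 * v4 - u4 * v1) (u2 * v3 - u3 * v2)"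
            by blast
          \<comment> \<open>The covectors are extended by 0 outside \<open>L\<close>, so that no
            reduction modulo the annihilator is needed to express them in the frame.\<close>
          define u where "u = (\<lambda>_. 0)(s1 := u1, s2 := u2, s3 := u3, s4 := u4)"
          define v where "v = (\<lambda>_. 0)(s1 := v1, s2 := v2, s3 := v3, s4 := v4)"
          have u: "u s1 = u1" "u s2 = u2" "u s3 = u3" "u s4 = u4"
            and v: "v s1 = v1" "v s2 = v2" "v s3 = v3" "v s4 = v4"
            using dist by (auto simp: u_def v_def)
          have hol: "hol n b = U b" "ahol n b = V b" if "\<And>s. s \<notin> set L \<Longrightarrow> b s = 0" for b
            unfolding hol_def ahol_def sumL[symmetric]
            using L(3) that by (auto intro!: sum.mono_neutral_right)
          have u0: "s \<notin> set L \<Longrightarrow> u s = 0" and v0: "s \<notin> set L \<Longrightarrow> v s = 0" for s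
            by (auto simp: L4 u_def v_def)
          have "U u * U v = (\<Sum>P\<in>UNIV. z P *\<^sub>C X P)"
            unfolding U_def X_def z u v by (rule one_form_mult_klein) simp_all
          moreover have "V u * V v = (\<Sum>P\<in>UNIV. cnj (z P) *\<^sub>C Y P)"
            unfolding V_def Y_def z u v klein_coord_cnj complex_cnj_diff complex_cnj_mult complex_cnj_i
            by (rule one_form_mult_klein) simp_all
          ultimately have om: "omega n u * omega n v = T (\<lambda>P R. z P * cnj (z R))"
            by (simp add: omega_mult_omega hol u0 v0 XsYs)
          \<comment> \<open>The covectors of \<open>\<beta>\<close> followed by \<open>u\<close> and
            \<open>v\<close>: these are \<open>m + 2 = n - 2\<close> in all, the number that
            positivity of \<open>\<alpha>\<close> tests.\<close>
          define g' where "g' = (\<lambda>k. if k < m then g k else if k = m then u else v)"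
          have "sp n g' (n - 2) = sp n g' (Suc (Suc m))" by (simp add: m)
          also have "\<dots> = sp n g' m * (omega n u * omega n v)" by (simp add: g'_def mult.assoc)
          also have "sp n g' m = \<beta>" unfolding \<beta>_def by (rule sp_cong) (simp add: g'_def)
          finally have "a * sp n g' (n - 2) = T A * \<beta> * T (\<lambda>P R. z P * cnj (z R))"
            unfolding om by (simp add: A[symmetric] mult.assoc)
          also have "\<dots> = T A * T (\<lambda>P R. z P * cnj (z R)) * \<beta>"
            using swapT by (metis mult.assoc)
          also have "\<dots> = (4 * (\<Sum>P\<in>UNIV. \<Sum>R\<in>UNIV. A P R * z P * cnj (z R)) * t) *\<^sub>C sp n delta n"
            unfolding TT by (simp add: \<tau>_def mult.assoc)
          finally obtain c :: real where c: "c \<ge> 0"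
            "(4 * (\<Sum>P\<in>UNIV. \<Sum>R\<in>UNIV. A P R * z P * cnj (z R)) * t) *\<^sub>C sp n delta n =
              complex_of_real c *\<^sub>C sp n delta n"
            using pos[of g'] by metis
          then have "4 * (\<Sum>P\<in>UNIV. \<Sum>R\<in>UNIV. A P R * z P * cnj (z R)) * t = complex_of_real c"
            using vol0 by simp
          then have "(\<Sum>P\<in>UNIV. \<Sum>R\<in>UNIV. A P R * z P * cnj (z R)) = complex_of_real (c / (4 * t))"
            using t by (simp add: field_simps)
          moreover have "c / (4 * t) \<ge> 0" using c t by simp
          ultimately show ?thesis by (simp only: nonneg_Reals_of_real_iff)
        qed
        then have "(\<Sum>P\<in>UNIV. \<Sum>R\<in>UNIV. (A P R)\<^sup>2) \<in> \<real>\<^sub>\<ge>\<^sub>0"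
          by (intro isotropic_nonneg_imp_sum_squares_nonneg) (simp_all add: card_six)
        then obtain r where r: "r \<ge> 0" "(\<Sum>P\<in>UNIV. \<Sum>R\<in>UNIV. (A P R)\<^sup>2) = complex_of_real r"
          by (auto elim: nonneg_Reals_cases)
        have "a * a * \<beta> = complex_of_real (4 * r * t) *\<^sub>C sp n delta n"
          unfolding square r by (simp add: \<tau>_def)
        then show ?thesis using r(1) L(4) unfolding \<beta>_def m_def
          by (intro exI[of _ "4 * r * t"]) simp
      qed
    qed
  qed
  then have "nonneg_top n (form_of (a * a * sp n g (n - 4)))" for g
    unfolding nonneg_top_form_of .
  then have "nonneg_top n (wedge (wedge \<alpha> \<alpha>) (sp_prod n g (n - 4)))" for g
    by (simp add: times_ext.rep_eq a form_of_sp)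
  moreover have "is_form n 4 4 (wedge \<alpha> \<alpha>)"
    using is_form_wedge[OF form\<alpha> form\<alpha>] by simp
  ultimately show ?thesis by (simp add: positive_form_def)
qed

end
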